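(* Let $G$ be a compact topological group. For every natural number $n\ge 2$, $(L^\infty(G),\|\cdot\|_{U_n})$ is a normed space.
   Context: $\mu_G$ is the Haar probability measure of $G$. For a bounded Borel measurable function $f:G\to\mathbb{C}$ and $n\ge 2$, $$\|f\|_{U_n}:=\Bigl(\int_{a_0,a_1,\dots,a_n\in G}\ \prod_{v\in\{0,1\}^n}J^{h(v)}f(a_0a_1^{v_1}a_2^{v_2}\cdots a_n^{v_n})~d\mu_G^{n+1}\Bigr)^{1/2^n},$$ where $J$ denotes complex conjugation (so $J^{h}f$ is $f$ for $h$ even and $\overline f$ for $h$ odd) and $h(v)=\sum_{i=1}^n v_i$. For $n\geq 2$ the integral is a nonnegative real number and the nonnegative root is taken. $L^\infty(G)$ is the complex vector space of bounded Borel functions on $G$ modulo equality $\mu_G$-almost everywhere. *)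

theory Defs
  imports "HOL-Probability.Probability" "HOL-Algebra.Algebraic_Closure_Type"
begin

text \<open>
  Groups are those of the type class \<open>topological_group_add\<close>. Its operation is written additively,
  but it is not assumed to be commutative, so the order of the factors is significant throughout.
  The Hausdorff property is not assumed. Compactness of the group is a hypothesis
  \<open>compact (UNIV :: 'a set)\<close> of the theorem.
\<close>

text \<open>
  In a compact Hausdorff space the closed sets are exactly the compact sets, so the last two
  clauses are the usual regularity of a Haar measure.
\<close>

definition haar_probability :: "'a::topological_group_add measure \<Rightarrow> bool" where
  "haar_probability \<mu> \<longleftrightarrow>
     sets \<mu> = sets borel \<and> prob_space \<mu> \<and>
     (\<forall>g. \<forall>B\<in>sets borel. emeasure \<mu> ((\<lambda>x. g + x) ` B) = emeasure \<mu> B) \<and>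
     (\<forall>B\<in>sets borel. emeasure \<mu> B = (INF U\<in>{U. open U \<and> B \<subseteq> U}. emeasure \<mu> U)) \<and>
     (\<forall>B\<in>sets borel. emeasure \<mu> B = (SUP K\<in>{K. closed K \<and> K \<subseteq> B}. emeasure \<mu> K))"

text \<open>
  If the group is not second countable, the product of the Borel \<open>\<sigma>\<close>-algebras can be strictly
  smaller than the Borel \<open>\<sigma>\<close>-algebra of the product space, and the group operation need not be
  measurable with respect to it. Haar measures of compact groups are completion regular (Kakutani
  and Kodaira), hence every Borel set of the \<open>(n + 1)\<close>-fold product belongs to the completed product
  \<open>\<sigma>\<close>-algebra, and there the completed product measure agrees with the Haar measure of the product
  group.
\<close>

definition haar_power :: "'a::topological_group_add measure \<Rightarrow> nat \<Rightarrow> (nat \<Rightarrow> 'a) measure" where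
  "haar_power \<mu> n = completion (\<Pi>\<^sub>M i\<in>{0..n}. \<mu>)"

text \<open>
  A vertex \<open>v\<close> of the discrete cube is a function from \<open>{1..n}\<close> to \<open>{0, 1}\<close>. In multiplicative
  notation \<open>cube_point n a v\<close> is the ordered product of \<open>a\<^sub>0\<close> and the \<open>v\<^sub>i\<close>-th powers of \<open>a\<^sub>i\<close>,
  for \<open>i\<close> from \<open>1\<close> to \<open>n\<close>.
\<close>

definition cube_point :: "nat \<Rightarrow> (nat \<Rightarrow> 'a::monoid_add) \<Rightarrow> (nat \<Rightarrow> nat) \<Rightarrow> 'a" where
  "cube_point n a v = a 0 + sum_list (map (\<lambda>i. if v i = 0 then 0 else a i) [1..<Suc n])"

definition gowers_integrand ::
    "nat \<Rightarrow> ('a::topological_group_add \<Rightarrow> complex) \<Rightarrow> (nat \<Rightarrow> 'a) \<Rightarrow> complex" where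
  "gowers_integrand n f a =
     (\<Prod>v\<in>{1..n} \<rightarrow>\<^sub>E {0, 1}. (cnj ^^ (\<Sum>i=1..n. v i)) (f (cube_point n a v)))"

definition gowers_integral ::
    "'a::topological_group_add measure \<Rightarrow> nat \<Rightarrow> ('a \<Rightarrow> complex) \<Rightarrow> complex" where
  "gowers_integral \<mu> n f = (\<integral>a. gowers_integrand n f a \<partial>haar_power \<mu> n)"

definition gowers_norm ::
    "'a::topological_group_add measure \<Rightarrow> nat \<Rightarrow> ('a \<Rightarrow> complex) \<Rightarrow> real" where
  "gowers_norm \<mu> n f = root (2 ^ n) (Re (gowers_integral \<mu> n f))"

definition bounded_borel :: "('a::topological_space \<Rightarrow> complex) set" where
  "bounded_borel = {f. f \<in> borel_measurable borel \<and> bounded (range f)}"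

definition ae_rel ::
    "'a::topological_space measure \<Rightarrow> (('a \<Rightarrow> complex) \<times> ('a \<Rightarrow> complex)) set" where
  "ae_rel \<mu> = {(f, g). f \<in> bounded_borel \<and> g \<in> bounded_borel \<and> (AE x in \<mu>. f x = g x)}"

text \<open>
  \<open>L\<^sup>\<infinity>\<close> as a set of equivalence classes. The ring multiplication and unit, which the record
  type of modules also demands, are the pointwise ones; they play no role in the notion of a
  module.
\<close>

definition Linf ::
    "'a::topological_space measure \<Rightarrow> (complex, ('a \<Rightarrow> complex) set) module" where
  "Linf \<mu> =
     \<lparr> carrier = bounded_borel // ae_rel \<mu>,
       monoid.mult = (\<lambda>A B. \<Union>f\<in>A. \<Union>g\<in>B. ae_rel \<mu> `` {\<lambda>x. f x * g x}),
       one = ae_rel \<mu> `` {\<lambda>x. 1},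
       zero = ae_rel \<mu> `` {\<lambda>x. 0},
       add = (\<lambda>A B. \<Union>f\<in>A. \<Union>g\<in>B. ae_rel \<mu> `` {\<lambda>x. f x + g x}),
       smult = (\<lambda>c A. \<Union>f\<in>A. ae_rel \<mu> `` {\<lambda>x. c * f x}) \<rparr>"

definition Linf_gowers_norm ::
    "'a::topological_group_add measure \<Rightarrow> nat \<Rightarrow> ('a \<Rightarrow> complex) set \<Rightarrow> real" where
  "Linf_gowers_norm \<mu> n A = gowers_norm \<mu> n (SOME f. f \<in> A)"

text \<open>
  A complex vector space is a module over the ring of complex numbers, that is, over
  \<open>ring_of_type_algebra :: complex ring\<close>.
\<close>

definition complex_normed_space :: "(complex, 'v) module \<Rightarrow> ('v \<Rightarrow> real) \<Rightarrow> bool" where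
  "complex_normed_space V N \<longleftrightarrow>
     module (ring_of_type_algebra :: complex ring) V \<and>
     (\<forall>x\<in>carrier V. 0 \<le> N x) \<and>
     (\<forall>x\<in>carrier V. N x = 0 \<longleftrightarrow> x = \<zero>\<^bsub>V\<^esub>) \<and>
     (\<forall>c. \<forall>x\<in>carrier V. N (c \<odot>\<^bsub>V\<^esub> x) = cmod c * N x) \<and>
     (\<forall>x\<in>carrier V. \<forall>y\<in>carrier V. N (x \<oplus>\<^bsub>V\<^esub> y) \<le> N x + N y)"

end

theory Submission
  imports Defs
begin

text \<open>
  If the group is not second countable, Haar measure is first restricted to the Baire sets, on whose
  products the group operation is measurable. Every Borel set is a Baire set up to a null set: an
  open \<open>U\<close> contains a cozero set \<open>{\<phi> > 0}\<close> of the same measure, and saturating \<open>U\<close> under the stabiliser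
  of \<open>\<phi>\<close> gives a Baire set of the same measure that contains \<open>U\<close>. So every bounded Borel function
  may be replaced by a Baire function.

  For Baire functions the measure is also right-invariant, and for every direction \<open>i\<close> a change of
  variables makes the two opposite faces of the cube independent given the remaining coordinates.
  Cauchy-Schwarz in each direction in turn gives the Gowers-Cauchy-Schwarz inequality, hence the
  triangle inequality. If the norm of \<open>f\<close> vanishes, the same inequality shows that
  \<open>f (a 0)\<close> is orthogonal to all functions of the other three vertices of a two-dimensional
  face; these determine \<open>a 0\<close>, so \<open>f = 0\<close> almost everywhere.
\<close>

section \<open>Gowers forms of an invariant probability\<close>

text \<open>Without second countability Fubini's theorem cannot be applied directly to the integrand
  of a Borel function. Baire sets repair this because a continuous real function on a compact group
  has a compact, hence separable, metric space of translates. Nothing is lost in the passage: each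
  vertex map pushes the product measure forward to Haar measure, so changing \<open>f\<close> on a
  null set changes the integrand on a null set. The group is not commutative, so the substitution
  that separates two opposite faces has to carry \<open>a 0\<close> across the factors before
  direction \<open>i\<close>. This conjugates those coordinates and therefore uses invariance on
  both sides. Definiteness is where \<open>2 \<le> n\<close> enters: for \<open>n = 1\<close> the
  expression is the absolute value of the integral of \<open>f\<close>, whereas two directions
  supply three further vertices of a face.\<close>

locale invariant_probability = prob_space M for M :: "'a::group_add measure" +
  assumes space_eq [simp]: "space M = UNIV"
    and measurable_plus: "(\<lambda>p. fst p + snd p) \<in> M \<Otimes>\<^sub>M M \<rightarrow>\<^sub>M M"
    and measurable_minus: "uminus \<in> M \<rightarrow>\<^sub>M M"
    and distr_plus_left: "distr M M ((+) g) = M"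
begin

lemma measurable_add [measurable (raw)]:
  assumes "f \<in> N \<rightarrow>\<^sub>M M" "h \<in> N \<rightarrow>\<^sub>M M"
  shows "(\<lambda>x. f x + h x) \<in> N \<rightarrow>\<^sub>M M"
  using measurable_compose[OF measurable_Pair[OF assms] measurable_plus] by simp

lemma measurable_uminus [measurable (raw)]:
  "f \<in> N \<rightarrow>\<^sub>M M \<Longrightarrow> (\<lambda>x. - f x) \<in> N \<rightarrow>\<^sub>M M"
  by (rule measurable_compose[OF _ measurable_minus])

lemma measurable_diff [measurable (raw)]:
  assumes "f \<in> N \<rightarrow>\<^sub>M M" "h \<in> N \<rightarrow>\<^sub>M M"
  shows "(\<lambda>x. f x - h x) \<in> N \<rightarrow>\<^sub>M M"
  unfolding diff_conv_add_uminus using assms by measurable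

lemma nn_integral_plus_left:
  assumes [measurable]: "f \<in> borel_measurable M"
  shows "(\<integral>\<^sup>+x. f (g + x) \<partial>M) = (\<integral>\<^sup>+x. f x \<partial>M)"
  using nn_integral_distr[of "(+) g" M M f] by (simp add: distr_plus_left)

text \<open>Averaging over a second variable \<open>y\<close> replaces \<open>f (- x)\<close> by
  \<open>f (- x + y)\<close>; integrating over \<open>y\<close> first, left invariance removes
  \<open>x\<close>. Right invariance follows from this.\<close>

lemma nn_integral_uminus:
  assumes [measurable]: "f \<in> borel_measurable M"
  shows "(\<integral>\<^sup>+x. f (- x) \<partial>M) = (\<integral>\<^sup>+x. f x \<partial>M)"
proof -
  interpret P: pair_sigma_finite M M ..
  have "(\<integral>\<^sup>+x. f (- x) \<partial>M) = (\<integral>\<^sup>+y. \<integral>\<^sup>+x. f (- x) \<partial>M \<partial>M)"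
    by (simp add: emeasure_space_1[simplified])
  also have "\<dots> = (\<integral>\<^sup>+y. \<integral>\<^sup>+x. f (- (- y + x)) \<partial>M \<partial>M)"
    by (subst nn_integral_plus_left) auto
  also have "\<dots> = (\<integral>\<^sup>+x. \<integral>\<^sup>+y. f (- x + y) \<partial>M \<partial>M)"
    using P.Fubini'[of "\<lambda>y x. f (- (- y + x))"] by (simp add: minus_add split_beta')
  also have "\<dots> = (\<integral>\<^sup>+x. \<integral>\<^sup>+y. f y \<partial>M \<partial>M)"
    by (subst nn_integral_plus_left) auto
  finally show ?thesis
    by (simp add: emeasure_space_1[simplified])
qed

lemma nn_integral_plus_right:
  assumes [measurable]: "f \<in> borel_measurable M"
  shows "(\<integral>\<^sup>+x. f (x + g) \<partial>M) = (\<integral>\<^sup>+x. f x \<partial>M)"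
proof -
  have "(\<integral>\<^sup>+x. f (x + g) \<partial>M) = (\<integral>\<^sup>+x. f (- (- g + x)) \<partial>M)"
    using nn_integral_uminus[of "\<lambda>x. f (x + g)"] by (simp add: minus_add)
  also have "\<dots> = (\<integral>\<^sup>+x. f x \<partial>M)"
    using nn_integral_plus_left[of "\<lambda>x. f (- x)" "- g"] nn_integral_uminus[of f] by simp
  finally show ?thesis .
qed

text \<open>The interval is half-open, so that segments concatenate and \<open>seg a v k k\<close>
  is neutral; \<open>a 0\<close> stays outside because the coordinate change treats it
  separately.\<close>

definition seg :: "(nat \<Rightarrow> 'a) \<Rightarrow> (nat \<Rightarrow> nat) \<Rightarrow> nat \<Rightarrow> nat \<Rightarrow> 'a" where
  "seg a v k l = sum_list (map (\<lambda>i. if v i = 0 then 0 else a i) [k..<l])"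

lemma cube_point_seg: "cube_point n a v = a 0 + seg a v 1 (Suc n)"
  by (simp add: cube_point_def seg_def)

lemma seg_cong:
  "(\<And>j. k \<le> j \<Longrightarrow> j < l \<Longrightarrow> v j = w j \<and> a j = b j) \<Longrightarrow> seg a v k l = seg b w k l"
  unfolding seg_def by (intro arg_cong[where f = sum_list] map_cong) auto

lemma seg_split: "1 \<le> i \<Longrightarrow> i \<le> n \<Longrightarrow>
  seg a v 1 (Suc n) = seg a v 1 i + (if v i = 0 then 0 else a i) + seg a v (Suc i) (Suc n)"
proof -
  assume i: "1 \<le> i" "i \<le> n"
  have "[1..<Suc n] = [1..<i] @ i # [Suc i..<Suc n]"
    using i upt_add_eq_append[of 1 i "Suc n - i"] upt_rec[of i "Suc n"] by simp
  then show ?thesis by (simp add: seg_def add.assoc)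
qed

text \<open>Conjugation is an automorphism fixing the neutral element, so it acts factor by factor,
  whichever factors \<open>v\<close> switches off.\<close>

lemma seg_conj: "seg (\<lambda>j. - g + a j + g) v k l = - g + seg a v k l + g"
proof -
  have "sum_list (map (\<lambda>i. if v i = 0 then 0 else - g + a i + g) xs) =
        - g + sum_list (map (\<lambda>i. if v i = 0 then 0 else a i) xs) + g" for xs :: "nat list"
    by (induction xs) (auto simp: add.assoc)
  then show ?thesis by (simp add: seg_def)
qed

text \<open>The index set \<open>I\<close> is arbitrary because segments reappear on the subproducts
  left after some coordinates are integrated out.\<close>

lemma measurable_seg [measurable]:
  assumes "{k..<l} \<subseteq> I"
  shows "(\<lambda>a. seg a v k l) \<in> (\<Pi>\<^sub>M i\<in>I. M) \<rightarrow>\<^sub>M M"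
proof -
  have "(\<lambda>a. sum_list (map (\<lambda>i. if v i = 0 then 0 else a i) xs)) \<in> (\<Pi>\<^sub>M i\<in>I. M) \<rightarrow>\<^sub>M M"
    if "set xs \<subseteq> I" for xs
    using that by (induction xs) auto
  from this[of "[k..<l]"] show ?thesis using assms by (simp add: seg_def)
qed

lemma measurable_cube_point [measurable]:
  "(\<lambda>a. cube_point n a v) \<in> (\<Pi>\<^sub>M i\<in>{0..n}. M) \<rightarrow>\<^sub>M M"
  unfolding cube_point_seg by (intro measurable_add measurable_seg measurable_component_singleton) auto

text \<open>
  In these coordinates the two faces of the cube in direction \<open>i\<close> carry the independent variables
  \<open>a 0\<close> and \<open>a i\<close>, between factors that are common to both faces.
\<close>

definition face_coords :: "nat \<Rightarrow> nat \<Rightarrow> (nat \<Rightarrow> 'a) \<Rightarrow> nat \<Rightarrow> 'a" where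
  "face_coords n i a = (\<lambda>j\<in>{0..n}. if j = 0 \<or> i < j then a j
                        else if j = i then - a 0 + a i else - a 0 + a j + a 0)"

text \<open>The leading \<open>a 0\<close> cancels against the conjugated segment and comes out
  behind it, directly before the factor of direction \<open>i\<close>. There it remains if
  \<open>v i = 0\<close> and is cancelled by \<open>- a 0 + a i\<close> otherwise.\<close>

lemma cube_point_face_coords:
  assumes "1 \<le> i" "i \<le> n"
  shows "cube_point n (face_coords n i a) v =
           seg a v 1 i + (if v i = 0 then a 0 else a i) + seg a v (Suc i) (Suc n)"
proof -
  have "seg (face_coords n i a) v 1 i = seg (\<lambda>j. - a 0 + a j + a 0) v 1 i"
    using assms by (intro seg_cong) (auto simp: face_coords_def)
  then have "seg (face_coords n i a) v 1 i = - a 0 + seg a v 1 i + a 0"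
    by (simp only: seg_conj)
  moreover have "seg (face_coords n i a) v (Suc i) (Suc n) = seg a v (Suc i) (Suc n)"
    using assms by (intro seg_cong) (auto simp: face_coords_def)
  moreover have "face_coords n i a 0 = a 0" "face_coords n i a i = - a 0 + a i"
    using assms by (auto simp: face_coords_def)
  ultimately show ?thesis
    by (simp add: cube_point_seg seg_split[OF assms] add.assoc del: One_nat_def)
qed

lemma product_sigma_finite: "product_sigma_finite (\<lambda>i. M)" ..

lemma measurable_face_coords [measurable]:
  "1 \<le> i \<Longrightarrow> i \<le> n \<Longrightarrow> face_coords n i \<in> (\<Pi>\<^sub>M i\<in>{0..n}. M) \<rightarrow>\<^sub>M (\<Pi>\<^sub>M i\<in>{0..n}. M)"
  unfolding face_coords_def by (rule measurable_restrict) auto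

text \<open>For fixed \<open>a 0 = x\<close> the map acts on every other coordinate separately, by
  the identity, a left translation or a conjugation, and all three preserve \<open>M\<close>. So
  boxes keep their measure, and boxes determine the product measure.\<close>

lemma distr_face_coords:
  assumes i: "1 \<le> i" "i \<le> n"
  shows "distr (\<Pi>\<^sub>M i\<in>{0..n}. M) (\<Pi>\<^sub>M i\<in>{0..n}. M) (face_coords n i) = (\<Pi>\<^sub>M i\<in>{0..n}. M)"
proof (rule product_sigma_finite.PiM_eqI[OF product_sigma_finite])
  fix A :: "nat \<Rightarrow> 'a set" assume A: "\<And>j. j \<in> {0..n} \<Longrightarrow> A j \<in> sets M"
  note [measurable] = A
  interpret product_sigma_finite "\<lambda>i. M" by (rule product_sigma_finite)
  let ?P = "\<Pi>\<^sub>M j\<in>{0..n}. M"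
  define T where "T x j y = (if i < j then y else if j = i then - x + y else - x + y + x)"
    for x y :: 'a and j
  have ins: "{0..n} = insert 0 {1..n}" by auto
  have [measurable]: "Pi\<^sub>E {0..n} A \<in> sets ?P"
    using A by (intro sets_PiM_I_finite) auto
  have [measurable]: "(\<lambda>y. T x j y) \<in> M \<rightarrow>\<^sub>M M" for x j
    unfolding T_def by (cases "i < j"; cases "j = i"; simp)
  have fc: "indicator (Pi\<^sub>E {0..n} A) (face_coords n i (a(0 := x))) =
      (indicator (A 0) x * (\<Prod>j\<in>{1..n}. indicator (A j) (T x j (a j))) :: ennreal)" for a x
  proof -
    have "face_coords n i (a(0 := x)) \<in> Pi\<^sub>E {0..n} A \<longleftrightarrow>
          x \<in> A 0 \<and> (\<forall>j\<in>{1..n}. T x j (a j) \<in> A j)"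
      using i unfolding PiE_iff ins Ball_def insert_iff
      by (auto simp: face_coords_def T_def split: if_splits)
    then show ?thesis
      by (auto simp: indicator_def prod_zero_iff)
  qed
  have meas: "(\<lambda>a. indicator (Pi\<^sub>E {0..n} A) (face_coords n i a) :: ennreal) \<in> borel_measurable ?P"
    using i by measurable
  have "emeasure (distr ?P ?P (face_coords n i)) (Pi\<^sub>E {0..n} A) =
        (\<integral>\<^sup>+a. indicator (Pi\<^sub>E {0..n} A) (face_coords n i a) \<partial>?P)"
    using i by (subst nn_integral_indicator[symmetric], simp, subst nn_integral_distr) auto
  \<comment> \<open>The coordinate \<open>a 0\<close> is integrated last, because all the maps
    \<open>T x j\<close> depend on it.\<close>
  also have "\<dots> = (\<integral>\<^sup>+x. \<integral>\<^sup>+a. indicator (Pi\<^sub>E {0..n} A) (face_coords n i (a(0 := x))) \<partial>(\<Pi>\<^sub>M j\<in>{1..n}. M) \<partial>M)"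
    using meas unfolding ins by (intro product_nn_integral_insert_rev) auto
  also have "\<dots> = (\<integral>\<^sup>+x. indicator (A 0) x * (\<integral>\<^sup>+a. (\<Prod>j\<in>{1..n}. indicator (A j) (T x j (a j))) \<partial>(\<Pi>\<^sub>M j\<in>{1..n}. M)) \<partial>M)"
    unfolding fc by (intro nn_integral_cong nn_integral_cmult) auto
  also have "\<dots> = (\<integral>\<^sup>+x. indicator (A 0) x * (\<Prod>j\<in>{1..n}. \<integral>\<^sup>+y. indicator (A j) (T x j y) \<partial>M) \<partial>M)"
    by (subst product_nn_integral_prod) auto
  also have "\<dots> = (\<integral>\<^sup>+x. indicator (A 0) x * (\<Prod>j\<in>{1..n}. emeasure M (A j)) \<partial>M)"
  proof -
    have "(\<integral>\<^sup>+y. indicator (A j) (T x j y) \<partial>M) = emeasure M (A j)" if j: "j \<in> {1..n}" for x j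
    proof -
      have [measurable]: "A j \<in> sets M" using A j by auto
      have "(\<integral>\<^sup>+y. indicator (A j) (- x + y + x) \<partial>M) = (\<integral>\<^sup>+y. indicator (A j) (y + x) \<partial>M)"
        using nn_integral_plus_left[of "\<lambda>y. indicator (A j) (y + x)" "- x"] by simp
      then show ?thesis
        using nn_integral_plus_right[of "indicator (A j)" x, OF borel_measurable_indicator]
          nn_integral_plus_left[of "indicator (A j)" "- x", OF borel_measurable_indicator] \<open>A j \<in> sets M\<close>
        unfolding T_def by (cases "i < j"; cases "j = i") simp_all
    qed
    then show ?thesis by simp
  qed
  also have "\<dots> = (\<Prod>j\<in>{0..n}. emeasure M (A j))"
    using A[of 0] unfolding ins by (simp add: nn_integral_multc)
  finally show "emeasure (distr ?P ?P (face_coords n i)) (Pi\<^sub>E {0..n} A) = (\<Prod>j\<in>{0..n}. emeasure M (A j))" .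
qed (use i in auto)


end

section \<open>Conjugation, Cauchy-Schwarz and the faces of the discrete cube\<close>

lemma norm_funpow_cnj [simp]: "cmod ((cnj ^^ k) z) = cmod z"
  by (induction k) auto

lemma funpow_cnj_mult: "(cnj ^^ k) (x * y) = (cnj ^^ k) x * (cnj ^^ k) y"
  by (induction k) auto

lemma funpow_cnj_add: "(cnj ^^ k) (x + y) = (cnj ^^ k) x + (cnj ^^ k) y"
  by (induction k) auto

lemma cnj_prod_funpow: "cnj (\<Prod>v\<in>A. (cnj ^^ k v) (z v)) = (\<Prod>v\<in>A. (cnj ^^ Suc (k v)) (z v))"
  by (simp add: cnj_prod)

lemma measurable_funpow_cnj [measurable (raw)]:
  "f \<in> borel_measurable N \<Longrightarrow> (\<lambda>x. (cnj ^^ k) (f x)) \<in> borel_measurable N"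
  by (induction k) (auto intro: borel_measurable_continuous_onI[THEN measurable_compose[rotated]] continuous_intros)

lemma (in finite_measure) integrable_bounded:
  fixes f :: "'a \<Rightarrow> 'b::{banach, second_countable_topology}"
  assumes "f \<in> borel_measurable M" "\<And>x. x \<in> space M \<Longrightarrow> norm (f x) \<le> C"
  shows "integrable M f"
  using assms by (intro integrable_const_bound[of f C]) (auto intro: AE_I2)

text \<open>Two parameters instead of one avoid a division: \<open>s = b\<close> and
  \<open>r = p\<close> give the claim up to the factor \<open>b\<close>.\<close>

lemma square_le_mult_of_quadratic_nonneg:
  fixes a b p :: real
  assumes "\<And>s r. 0 \<le> s\<^sup>2 * a - 2 * s * r * p + r\<^sup>2 * b" "0 \<le> b" "0 \<le> p"
  shows "p\<^sup>2 \<le> a * b"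
proof (cases "b = 0")
  case True
  have "p = 0"
  proof (rule ccontr)
    assume "p \<noteq> 0"
    \<comment> \<open>With \<open>b = 0\<close> the form is linear in \<open>r\<close>, and this
      \<open>r\<close> makes it equal to \<open>- 1\<close>.\<close>
    then show False using assms(1)[of 1 "(a + 1) / (2 * p)"] True by (simp add: field_simps)
  qed
  then show ?thesis using True by simp
next
  case False
  have "0 \<le> b * (a * b - p\<^sup>2)"
    using assms(1)[of b p] by (simp add: power2_eq_square algebra_simps)
  then show ?thesis using False assms(2) by (simp add: zero_le_mult_iff)
qed

lemma (in finite_measure) Cauchy_Schwarz_integral:
  fixes f g :: "'a \<Rightarrow> complex"
  assumes [measurable]: "f \<in> borel_measurable M" "g \<in> borel_measurable M"
    and bf: "\<And>x. x \<in> space M \<Longrightarrow> cmod (f x) \<le> C" and bg: "\<And>x. x \<in> space M \<Longrightarrow> cmod (g x) \<le> D"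
  shows "(cmod (\<integral>x. f x * cnj (g x) \<partial>M))\<^sup>2 \<le> (\<integral>x. (cmod (f x))\<^sup>2 \<partial>M) * (\<integral>x. (cmod (g x))\<^sup>2 \<partial>M)"
proof -
  define p where "p = (\<integral>x. cmod (f x) * cmod (g x) \<partial>M)"
  have [measurable]: "(\<lambda>x. cnj (g x)) \<in> borel_measurable M"
    using measurable_funpow_cnj[of g M 1] by simp
  have i1: "integrable M (\<lambda>x. (cmod (f x))\<^sup>2)"
    by (rule integrable_bounded[of _ "C\<^sup>2"]) (auto intro: power_mono bf)
  have i2: "integrable M (\<lambda>x. (cmod (g x))\<^sup>2)"
    by (rule integrable_bounded[of _ "D\<^sup>2"]) (auto intro: power_mono bg)
  have i3: "integrable M (\<lambda>x. cmod (f x) * cmod (g x))"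
    by (rule integrable_bounded[of _ "C * D"])
       (auto simp: norm_mult intro!: mult_mono bf bg intro: order_trans[OF norm_ge_zero bf])
  have "cmod (\<integral>x. f x * cnj (g x) \<partial>M) \<le> p"
    unfolding p_def by (rule order_trans[OF integral_norm_bound]) (simp add: norm_mult)
  then have "(cmod (\<integral>x. f x * cnj (g x) \<partial>M))\<^sup>2 \<le> p\<^sup>2"
    by (intro power_mono) auto
  also have "p\<^sup>2 \<le> (\<integral>x. (cmod (f x))\<^sup>2 \<partial>M) * (\<integral>x. (cmod (g x))\<^sup>2 \<partial>M)"
  proof (rule square_le_mult_of_quadratic_nonneg)
    fix s r :: real
    have "0 \<le> (\<integral>x. (s * cmod (f x) - r * cmod (g x))\<^sup>2 \<partial>M)" by simp
    also have "\<dots> = (\<integral>x. s\<^sup>2 * (cmod (f x))\<^sup>2 - 2 * s * r * (cmod (f x) * cmod (g x)) + r\<^sup>2 * (cmod (g x))\<^sup>2 \<partial>M)"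
      by (intro Bochner_Integration.integral_cong) (auto simp: power2_eq_square algebra_simps)
    also have "\<dots> = s\<^sup>2 * (\<integral>x. (cmod (f x))\<^sup>2 \<partial>M) - 2 * s * r * p + r\<^sup>2 * (\<integral>x. (cmod (g x))\<^sup>2 \<partial>M)"
      using i1 i2 i3 by (simp add: p_def)
    finally show "0 \<le> s\<^sup>2 * (\<integral>x. (cmod (f x))\<^sup>2 \<partial>M) - 2 * s * r * p + r\<^sup>2 * (\<integral>x. (cmod (g x))\<^sup>2 \<partial>M)" .
  qed (auto simp: p_def)
  finally show ?thesis .
qed

definition cube :: "nat \<Rightarrow> (nat \<Rightarrow> nat) set" where
  "cube n = {1..n} \<rightarrow>\<^sub>E {0, 1}"

lemma finite_cube [simp]: "finite (cube n)"
  unfolding cube_def by (intro finite_PiE) auto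

lemma fun_upd_cube: "v \<in> cube n \<Longrightarrow> i \<in> {1..n} \<Longrightarrow> j \<in> {0, 1} \<Longrightarrow> v(i := j) \<in> cube n"
  by (auto simp: cube_def PiE_iff extensional_def)

text \<open>Both products run over the lower face \<open>v i = 0\<close>, so that opposite faces can
  be compared vertex by vertex.\<close>

lemma prod_cube_faces:
  fixes \<phi> :: "(nat \<Rightarrow> nat) \<Rightarrow> 'b::comm_monoid_mult"
  assumes i: "i \<in> {1..n}"
  shows "(\<Prod>v\<in>cube n. \<phi> v) =
         (\<Prod>v\<in>{v\<in>cube n. v i = 0}. \<phi> v) * (\<Prod>v\<in>{v\<in>cube n. v i = 0}. \<phi> (v(i := 1)))"
proof -
  have split: "cube n = {v\<in>cube n. v i = 0} \<union> {v\<in>cube n. v i = 1}"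
    using i PiE_mem[of _ "{1..n}" "\<lambda>_. {0, 1}" i] unfolding cube_def by blast
  have im: "{v\<in>cube n. v i = 1} = (\<lambda>v. v(i := 1)) ` {v\<in>cube n. v i = 0}"
  proof (intro equalityI subsetI)
    fix v assume v: "v \<in> {v\<in>cube n. v i = 1}"
    then have "v = (v(i := 0))(i := 1)" "v(i := 0) \<in> {v\<in>cube n. v i = 0}"
      using fun_upd_cube[of v n i 0] i by (auto simp: fun_eq_iff)
    then show "v \<in> (\<lambda>v. v(i := 1)) ` {v\<in>cube n. v i = 0}" by (rule image_eqI)
  qed (use i fun_upd_cube[of _ n i 1] in auto)
  have inj: "inj_on (\<lambda>v. v(i := 1)) {v\<in>cube n. v i = 0}"
  proof (rule inj_onI)
    fix v w assume "v \<in> {v\<in>cube n. v i = 0}" "w \<in> {v\<in>cube n. v i = 0}" "v(i := 1) = w(i := 1)"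
    then show "v = w" by (metis (mono_tags, lifting) fun_upd_triv fun_upd_upd mem_Collect_eq)
  qed
  have "(\<Prod>v\<in>cube n. \<phi> v) = (\<Prod>v\<in>{v\<in>cube n. v i = 0}. \<phi> v) * (\<Prod>v\<in>{v\<in>cube n. v i = 1}. \<phi> v)"
    by (subst split, rule prod.union_disjoint) auto
  also have "(\<Prod>v\<in>{v\<in>cube n. v i = 1}. \<phi> v) = (\<Prod>v\<in>{v\<in>cube n. v i = 0}. \<phi> (v(i := 1)))"
    unfolding im by (simp add: prod.reindex[OF inj] del: One_nat_def)
  finally show ?thesis .
qed

text \<open>Passing to the opposite face changes the parity of a vertex; this is where the complex
  conjugate in the Cauchy-Schwarz pairing comes from.\<close>

lemma sum_fun_upd_Suc:
  fixes v :: "nat \<Rightarrow> nat"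
  assumes "i \<in> {1..n}" "v i = 0"
  shows "(\<Sum>j=1..n. (v(i := 1)) j) = Suc (\<Sum>j=1..n. v j)"
proof -
  have "(\<Sum>j=1..n. (v(i := 1)) j) = 1 + (\<Sum>j\<in>{1..n} - {i}. (v(i := 1)) j)"
    using assms by (subst sum.remove[of _ i]) auto
  also have "(\<Sum>j\<in>{1..n} - {i}. (v(i := 1)) j) = (\<Sum>j\<in>{1..n} - {i}. v j)"
    by (intro sum.cong) auto
  also have "\<dots> = (\<Sum>j=1..n. v j)"
    using assms by (subst (2) sum.remove[of _ i]) auto
  finally show ?thesis by simp
qed


text \<open>For the induction over directions in \<open>gowers_form_override\<close>: a new
  direction doubles every partial vertex.\<close>

lemma cube_override_insert:
  assumes "i \<notin> S" "finite S"
  shows "(\<Prod>u\<in>insert i S \<rightarrow>\<^sub>E {0, 1::nat}. \<phi> u) =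
         (\<Prod>u\<in>S \<rightarrow>\<^sub>E {0, 1}. \<phi> (u(i := 0)) * \<phi> (u(i := 1)) :: real)"
proof -
  let ?q = "\<lambda>(y, g). g(i := y)"
  have "(\<Prod>u\<in>insert i S \<rightarrow>\<^sub>E {0, 1::nat}. \<phi> u) = (\<Prod>p\<in>{0, 1::nat} \<times> (S \<rightarrow>\<^sub>E {0, 1}). \<phi> (?q p))"
    unfolding PiE_insert_eq
    by (subst prod.reindex) (use inj_combinator[OF assms(1), of "\<lambda>_. {0, 1::nat}"] in auto)
  also have "\<dots> = (\<Prod>y\<in>{0, 1}. \<Prod>g\<in>S \<rightarrow>\<^sub>E {0, 1}. \<phi> (g(i := y)))"
    by (simp add: prod.cartesian_product split_beta')
  also have "\<dots> = (\<Prod>u\<in>S \<rightarrow>\<^sub>E {0, 1}. \<phi> (u(i := 0)) * \<phi> (u(i := 1)))"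
    by (simp add: prod.distrib)
  finally show ?thesis .
qed

text \<open>Each vertex carries its own function, as polarisation requires; the constant family
  \<open>\<lambda>v. f\<close> gives back \<open>gowers_integrand\<close>.\<close>

definition gowers_kernel ::
    "nat \<Rightarrow> ((nat \<Rightarrow> nat) \<Rightarrow> 'a::monoid_add \<Rightarrow> complex) \<Rightarrow> (nat \<Rightarrow> 'a) \<Rightarrow> complex" where
  "gowers_kernel n F a = (\<Prod>v\<in>cube n. (cnj ^^ (\<Sum>i=1..n. v i)) (F v (cube_point n a v)))"

section \<open>Gowers forms and their factorisation over two opposite faces\<close>

context invariant_probability
begin

definition bounded_measurable :: "('a \<Rightarrow> complex) set" where
  "bounded_measurable = {f \<in> borel_measurable M. bounded (range f)}"

lemma bounded_measurableD [measurable_dest]: "f \<in> bounded_measurable \<Longrightarrow> f \<in> borel_measurable M"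
  by (simp add: bounded_measurable_def)

lemma bounded_measurable_bound:
  assumes "f \<in> bounded_measurable"
  obtains C where "0 \<le> C" "\<And>x. cmod (f x) \<le> C"
  using assms unfolding bounded_measurable_def bounded_iff
  by (smt (verit, best) mem_Collect_eq norm_ge_zero rangeI)

lemma bounded_measurable_family_bound:
  assumes "finite V" "\<And>v. v \<in> V \<Longrightarrow> F v \<in> bounded_measurable"
  obtains C where "\<And>v. v \<in> V \<Longrightarrow> 0 \<le> C v" "\<And>v x. v \<in> V \<Longrightarrow> cmod (F v x) \<le> C v"
proof -
  have "\<exists>C. \<forall>v\<in>V. 0 \<le> C v \<and> (\<forall>x. cmod (F v x) \<le> C v)"
    using assms(2) by (intro bchoice ballI) (meson bounded_measurable_bound)
  then show thesis using that by blast
qed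

abbreviation P :: "nat \<Rightarrow> (nat \<Rightarrow> 'a) measure" where
  "P n \<equiv> \<Pi>\<^sub>M i\<in>{0..n}. M"

text \<open>The Gowers inner product, linear or conjugate-linear in each entry according to the
  parity of the vertex.\<close>

definition gowers_form :: "nat \<Rightarrow> ((nat \<Rightarrow> nat) \<Rightarrow> 'a \<Rightarrow> complex) \<Rightarrow> complex" where
  "gowers_form n F = (\<integral>a. gowers_kernel n F a \<partial>P n)"

lemma prob_space_PiM_M: "prob_space (\<Pi>\<^sub>M i\<in>I. M)"
  by (intro prob_space_PiM prob_space_axioms)

lemma gowers_form_cong: "(\<And>v. v \<in> cube n \<Longrightarrow> F v = G v) \<Longrightarrow> gowers_form n F = gowers_form n G"
  by (simp add: gowers_form_def gowers_kernel_def cong: prod.cong)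

lemma measurable_gowers_kernel [measurable]:
  assumes "\<And>v. v \<in> cube n \<Longrightarrow> F v \<in> borel_measurable M"
  shows "gowers_kernel n F \<in> borel_measurable (P n)"
  unfolding gowers_kernel_def
  by (intro borel_measurable_prod measurable_funpow_cnj measurable_compose[OF measurable_cube_point] assms)

lemma integrable_gowers_kernel:
  assumes F: "\<And>v. v \<in> cube n \<Longrightarrow> F v \<in> bounded_measurable"
  shows "integrable (P n) (gowers_kernel n F)"
proof -
  interpret P: prob_space "P n" by (rule prob_space_PiM_M)
  obtain C where C: "\<And>v. v \<in> cube n \<Longrightarrow> 0 \<le> C v" "\<And>v x. v \<in> cube n \<Longrightarrow> cmod (F v x) \<le> C v"
    using bounded_measurable_family_bound[of "cube n" F] F by auto
  show ?thesis
    using F C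
    by (intro P.integrable_bounded[of _ "\<Prod>v\<in>cube n. C v"] measurable_gowers_kernel bounded_measurableD)
       (auto simp: gowers_kernel_def prod_norm[symmetric] intro!: prod_mono)
qed

text \<open>The part of the integrand on one face in direction \<open>i\<close>; \<open>x\<close>
  stands where the coordinate change has put \<open>a 0\<close> or \<open>a i\<close>. Indexing by
  the lower face lets one formula serve both faces, the upper one up to conjugation.\<close>

definition face_kernel :: "nat \<Rightarrow> nat \<Rightarrow> ((nat \<Rightarrow> nat) \<Rightarrow> 'a \<Rightarrow> complex) \<Rightarrow> 'a \<Rightarrow> (nat \<Rightarrow> 'a) \<Rightarrow> complex" where
  "face_kernel n i F x c = (\<Prod>v\<in>{v\<in>cube n. v i = 0}.
     (cnj ^^ (\<Sum>j=1..n. v j)) (F v (seg c v 1 i + x + seg c v (Suc i) (Suc n))))"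

text \<open>This family ignores \<open>v i\<close>: it carries the functions of the face
  \<open>v i = k\<close> on both faces.\<close>

abbreviation face :: "nat \<Rightarrow> nat \<Rightarrow> ((nat \<Rightarrow> nat) \<Rightarrow> 'a \<Rightarrow> complex) \<Rightarrow> (nat \<Rightarrow> nat) \<Rightarrow> 'a \<Rightarrow> complex" where
  "face i k F \<equiv> \<lambda>v. F (v(i := k))"

lemma face_kernel_cong:
  assumes i: "i \<in> {1..n}" and "\<And>j. j \<in> {1..n} - {i} \<Longrightarrow> c j = d j"
  shows "face_kernel n i F x c = face_kernel n i F x d"
proof -
  have "seg c v 1 i = seg d v 1 i" "seg c v (Suc i) (Suc n) = seg d v (Suc i) (Suc n)" for v
    using assms i by (intro seg_cong; auto)+
  then show ?thesis by (simp add: face_kernel_def)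
qed

text \<open>In the new coordinates the lower face involves \<open>a 0\<close> but not
  \<open>a i\<close>, and the upper face \<open>a i\<close> but not \<open>a 0\<close>. The extra
  unit in the height of an upper vertex becomes the outer conjugation.\<close>

lemma gowers_kernel_face_coords:
  assumes i: "i \<in> {1..n}"
  shows "gowers_kernel n F (face_coords n i a) =
           face_kernel n i (face i 0 F) (a 0) a * cnj (face_kernel n i (face i 1 F) (a i) a)"
proof -
  have eq: "cube_point n (face_coords n i a) v =
      seg a v 1 i + (if v i = 0 then a 0 else a i) + seg a v (Suc i) (Suc n)" for v
    using i by (intro cube_point_face_coords) auto
  have upd: "seg a (v(i := 1)) 1 i = seg a v 1 i"
    "seg a (v(i := 1)) (Suc i) (Suc n) = seg a v (Suc i) (Suc n)" for v
    by (intro seg_cong; auto)+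
  have 0: "v(i := 0) = v" if "v i = 0" for v :: "nat \<Rightarrow> nat"
    using that by (auto simp: fun_eq_iff)
  show ?thesis
    unfolding gowers_kernel_def prod_cube_faces[OF i] face_kernel_def cnj_prod_funpow eq upd
    using sum_fun_upd_Suc[OF i]
    by (intro arg_cong2[where f = "(*)"] prod.cong) (auto simp: 0)
qed


lemma measurable_face_kernel:
  assumes F: "\<And>v. v \<in> cube n \<Longrightarrow> F v \<in> borel_measurable M"
    and h [measurable]: "h \<in> N \<rightarrow>\<^sub>M M" "k \<in> N \<rightarrow>\<^sub>M (\<Pi>\<^sub>M j\<in>I. M)" and i: "i \<in> {1..n}" "{1..n} - {i} \<subseteq> I"
  shows "(\<lambda>x. face_kernel n i F (h x) (k x)) \<in> borel_measurable N"
proof -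
  have 1: "(\<lambda>x. seg (k x) v 1 i) \<in> N \<rightarrow>\<^sub>M M" for v
    by (rule measurable_compose[OF h(2) measurable_seg]) (use i in auto)
  have 2: "(\<lambda>x. seg (k x) v (Suc i) (Suc n)) \<in> N \<rightarrow>\<^sub>M M" for v
    by (rule measurable_compose[OF h(2) measurable_seg]) (use i in auto)
  show ?thesis
    unfolding face_kernel_def
    by (intro borel_measurable_prod measurable_funpow_cnj measurable_compose[OF _ F] measurable_add 1 2 h) auto
qed

lemma face_kernel_bound:
  assumes F: "\<And>v. v \<in> cube n \<Longrightarrow> F v \<in> bounded_measurable"
  obtains C where "0 \<le> C" "\<And>x c. cmod (face_kernel n i F x c) \<le> C"
proof -
  obtain C where C: "\<And>v. v \<in> cube n \<Longrightarrow> 0 \<le> C v" "\<And>v x. v \<in> cube n \<Longrightarrow> cmod (F v x) \<le> C v"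
    using bounded_measurable_family_bound[of "cube n" F] F by (metis finite_cube)
  show thesis
  proof (rule that[of "\<Prod>v\<in>{v\<in>cube n. v i = 0}. C v"])
    show "cmod (face_kernel n i F x c) \<le> (\<Prod>v\<in>{v\<in>cube n. v i = 0}. C v)" for x c
      using C by (auto simp: face_kernel_def prod_norm[symmetric] intro!: prod_mono)
  qed (auto intro!: prod_nonneg C)
qed

definition face_integral :: "nat \<Rightarrow> nat \<Rightarrow> ((nat \<Rightarrow> nat) \<Rightarrow> 'a \<Rightarrow> complex) \<Rightarrow> (nat \<Rightarrow> 'a) \<Rightarrow> complex" where
  "face_integral n i F c = (\<integral>x. face_kernel n i F x c \<partial>M)"

lemma measurable_face_integral:
  assumes F: "\<And>v. v \<in> cube n \<Longrightarrow> F v \<in> borel_measurable M" and i: "i \<in> {1..n}" "{1..n} - {i} \<subseteq> I"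
  shows "face_integral n i F \<in> borel_measurable (\<Pi>\<^sub>M j\<in>I. M)"
proof -
  have "(\<lambda>c. \<integral>x. face_kernel n i F x c \<partial>M) \<in> borel_measurable (\<Pi>\<^sub>M j\<in>I. M)"
    by (rule borel_measurable_lebesgue_integral)
       (simp add: split_beta', rule measurable_face_kernel[OF F], use i in auto)
  then show ?thesis by (simp add: face_integral_def[abs_def])
qed

lemma face_integral_bound:
  assumes F: "\<And>v. v \<in> cube n \<Longrightarrow> F v \<in> bounded_measurable" and i: "i \<in> {1..n}"
  obtains C where "0 \<le> C" "\<And>c. c \<in> space (\<Pi>\<^sub>M j\<in>{1..n} - {i}. M) \<Longrightarrow> cmod (face_integral n i F c) \<le> C"
proof -
  obtain C where C: "0 \<le> C" "\<And>x c. cmod (face_kernel n i F x c) \<le> C"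
    using face_kernel_bound[of n F i] F by blast
  have "cmod (face_integral n i F c) \<le> C" if c: "c \<in> space (\<Pi>\<^sub>M j\<in>{1..n} - {i}. M)" for c
  proof -
    have m: "(\<lambda>x. face_kernel n i F x c) \<in> borel_measurable M"
      by (rule measurable_face_kernel[where I = "{1..n} - {i}"]) (use F i c in \<open>auto intro: bounded_measurableD\<close>)
    have "cmod (face_integral n i F c) \<le> (\<integral>x. cmod (face_kernel n i F x c) \<partial>M)"
      unfolding face_integral_def by (rule integral_norm_bound)
    also have "\<dots> \<le> (\<integral>x. C \<partial>M)"
      using m C by (intro integral_mono) (auto intro!: integrable_bounded[of _ C])
    finally show ?thesis by (simp add: prob_space[simplified])
  qed
  then show thesis using that C by blast
qed

text \<open>Given the coordinates other than \<open>0\<close> and \<open>i\<close>, the two faces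
  depend on independent variables. Integrating out \<open>a i\<close> and then \<open>a 0\<close>
  leaves a product of two conditional integrals, to which Cauchy-Schwarz applies.\<close>

lemma gowers_form_faces:
  assumes F: "\<And>v. v \<in> cube n \<Longrightarrow> F v \<in> bounded_measurable" and i: "i \<in> {1..n}"
  shows "gowers_form n F = (\<integral>c. face_integral n i (face i 0 F) c * cnj (face_integral n i (face i 1 F) c)
           \<partial>(\<Pi>\<^sub>M j\<in>{1..n} - {i}. M))"
proof -
  interpret product_sigma_finite "\<lambda>i. M" by (rule product_sigma_finite)
  define J where "J = {1..n} - {i}"
  have J: "finite J" "0 \<notin> J" "i \<notin> insert 0 J" "{0..n} = insert i (insert 0 J)"
    using i by (auto simp: J_def)
  have F': "face i k F v \<in> bounded_measurable" if "v \<in> cube n" "k \<in> {0, 1}" for v k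
    using F fun_upd_cube i that by blast
  let ?K = "\<lambda>k. face_kernel n i (face i k F)"
  let ?A = "\<lambda>k. face_integral n i (face i k F)"
  define g where "g = (\<lambda>a. ?K 0 (a 0) a * cnj (?K 1 (a i) a))"
  have g: "gowers_kernel n F (face_coords n i a) = g a" for a
    using gowers_kernel_face_coords[OF i] by (simp add: g_def)
  have int_g: "integrable (P n) g"
    using integrable_distr[of "face_coords n i" "P n" "P n" "gowers_kernel n F"]
      integrable_gowers_kernel[OF F] i distr_face_coords[of i n] by (simp add: g)
  have mA: "?A k \<in> borel_measurable (\<Pi>\<^sub>M j\<in>I. M)" if "k \<in> {0, 1}" "J \<subseteq> I" for k I
    using F' i that by (intro measurable_face_integral) (auto simp: J_def intro: bounded_measurableD)
  have mA': "(\<lambda>b. cnj (?A 1 b)) \<in> borel_measurable (\<Pi>\<^sub>M j\<in>insert 0 J. M)"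
    using measurable_funpow_cnj[OF mA[of 1 "insert 0 J"], of 1] by auto
  have ms: "(\<lambda>b. ?K 0 (b 0) b * cnj (?A 1 b)) \<in> borel_measurable (\<Pi>\<^sub>M j\<in>insert 0 J. M)"
    using F' i
    by (intro borel_measurable_times measurable_face_kernel[where I = "insert 0 J"] mA')
       (auto simp: J_def intro: bounded_measurableD)
  have Kc: "?K k x (b(j := y)) = ?K k x b" if "j \<notin> J" for k x b j y
    by (rule face_kernel_cong[OF i]) (use that in \<open>auto simp: J_def\<close>)
  have Ac: "?A k (b(j := y)) = ?A k b" if "j \<notin> J" for k b j y
    unfolding face_integral_def Kc[OF that] ..
  have "gowers_form n F = (\<integral>a. g a \<partial>P n)"
    unfolding gowers_form_def
    using integral_distr[of "face_coords n i" "P n" "P n" "gowers_kernel n F"]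
      integrable_gowers_kernel[OF F] i distr_face_coords[of i n] by (simp add: g)
  also have "\<dots> = (\<integral>b. \<integral>y. g (b(i := y)) \<partial>M \<partial>(\<Pi>\<^sub>M j\<in>insert 0 J. M))"
    unfolding J(4) using int_g J by (intro product_integral_insert) auto
  also have "\<dots> = (\<integral>b. ?K 0 (b 0) b * cnj (?A 1 b) \<partial>(\<Pi>\<^sub>M j\<in>insert 0 J. M))"
    using i J by (simp add: g_def Kc face_integral_def)
  also have "\<dots> = (\<integral>c. \<integral>x. ?K 0 x (c(0 := x)) * cnj (?A 1 (c(0 := x))) \<partial>M \<partial>(\<Pi>\<^sub>M j\<in>J. M))"
  proof -
    interpret Q: prob_space "\<Pi>\<^sub>M j\<in>insert 0 J. M" by (rule prob_space_PiM_M)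
    obtain C where C: "0 \<le> C" "\<And>x c. cmod (?K 0 x c) \<le> C"
      using face_kernel_bound[of n "face i 0 F" i] F' by blast
    obtain D where D: "0 \<le> D" "\<And>c. c \<in> space (\<Pi>\<^sub>M j\<in>{1..n} - {i}. M) \<Longrightarrow> cmod (?A 1 c) \<le> D"
      using face_integral_bound[of n "face i 1 F" i] F' i by blast
    \<comment> \<open>The bound \<open>D\<close> covers only points of the product over
      \<open>J\<close>; any other \<open>b\<close> reduces to such a point, because only the
      coordinates in \<open>J\<close> matter.\<close>
    have "cmod (?A 1 b) \<le> D" for b
    proof -
      have "?A 1 b = ?A 1 (restrict b J)"
        unfolding face_integral_def
        by (intro Bochner_Integration.integral_cong face_kernel_cong[OF i]) (auto simp: J_def)
      then show ?thesis using D(2)[of "restrict b J"] by (simp add: J_def space_PiM)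
    qed
    then have "integrable (\<Pi>\<^sub>M j\<in>insert 0 J. M) (\<lambda>b. ?K 0 (b 0) b * cnj (?A 1 b))"
      using ms C D by (intro Q.integrable_bounded[of _ "C * D"]) (auto simp: norm_mult intro!: mult_mono)
    then show ?thesis by (simp add: product_integral_insert[OF J(1,2)])
  qed
  also have "\<dots> = (\<integral>c. ?A 0 c * cnj (?A 1 c) \<partial>(\<Pi>\<^sub>M j\<in>J. M))"
    using J by (simp add: Kc Ac face_integral_def)
  finally show ?thesis by (simp add: J_def)
qed


end

text \<open>The sets \<open>E\<close> with vanishing integral form a Dynkin system, and the
  rectangles are an intersection-stable generator. The weight \<open>g\<close> is complex, so the
  closure properties are checked on the integrals themselves.\<close>

lemma integral_indicator_pair_eq_0:
  fixes g :: "'b \<Rightarrow> complex"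
  assumes g: "integrable Q g" and \<xi> [measurable]: "\<xi> \<in> Q \<rightarrow>\<^sub>M M1" and \<eta> [measurable]: "\<eta> \<in> Q \<rightarrow>\<^sub>M M2"
    and rect: "\<And>A B. A \<in> sets M1 \<Longrightarrow> B \<in> sets M2 \<Longrightarrow> (\<integral>x. g x * (indicator A (\<xi> x) * indicator B (\<eta> x)) \<partial>Q) = 0"
    and E: "E \<in> sets (M1 \<Otimes>\<^sub>M M2)"
  shows "(\<integral>x. g x * indicator E (\<xi> x, \<eta> x) \<partial>Q) = 0"
proof -
  let ?\<Omega> = "space M1 \<times> space M2"
  let ?I = "\<lambda>E. \<integral>x. g x * indicator E (\<xi> x, \<eta> x) \<partial>Q"
  have [measurable]: "g \<in> borel_measurable Q" using g by auto
  have img: "(\<xi> x, \<eta> x) \<in> ?\<Omega>" if "x \<in> space Q" for x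
    using measurable_space[OF \<xi> that] measurable_space[OF \<eta> that] by simp
  have sets: "sigma_sets ?\<Omega> {a \<times> b |a b. a \<in> sets M1 \<and> b \<in> sets M2} = sets (M1 \<Otimes>\<^sub>M M2)"
    by (rule sets_pair_measure[symmetric])
  have int: "integrable Q (\<lambda>x. g x * indicator E (\<xi> x, \<eta> x))" if [measurable]: "E \<in> sets (M1 \<Otimes>\<^sub>M M2)" for E
    by (rule Bochner_Integration.integrable_bound[OF g]) (auto simp: norm_mult indicator_def)
  have "E \<in> sigma_sets ?\<Omega> {a \<times> b |a b. a \<in> sets M1 \<and> b \<in> sets M2}"
    using E by (simp add: sets)
  then show ?thesis
  proof (induction rule: sigma_sets_induct_disjoint[OF Int_stable_pair_measure_generator pair_measure_closed,
      consumes 1, case_names basic empty compl union])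
    case (basic E)
    then obtain A B where "E = A \<times> B" "A \<in> sets M1" "B \<in> sets M2" by auto
    then show ?case using rect[of A B] by (simp add: indicator_times)
  next
    case empty
    then show ?case by simp
  next
    case (compl E)
    \<comment> \<open>The whole space is itself a rectangle, so the first integral vanishes by
      \<open>rect\<close>.\<close>
    have "?I (?\<Omega> - E) = (\<integral>x. g x * (indicator (space M1) (\<xi> x) * indicator (space M2) (\<eta> x)) - g x * indicator E (\<xi> x, \<eta> x) \<partial>Q)"
      using img by (intro Bochner_Integration.integral_cong) (auto simp: indicator_def)
    also have "\<dots> = (\<integral>x. g x * (indicator (space M1) (\<xi> x) * indicator (space M2) (\<eta> x)) \<partial>Q) - ?I E"
      using int[of E] compl int[of ?\<Omega>] by (subst Bochner_Integration.integral_diff) (auto simp: sets indicator_times)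
    finally show ?case using compl rect by simp
  next
    case (union A)
    have A [measurable]: "A i \<in> sets (M1 \<Otimes>\<^sub>M M2)" for i
      using union.hyps(2) sets by auto
    have B [measurable]: "(\<Union>i<k. A i) \<in> sets (M1 \<Otimes>\<^sub>M M2)" for k :: nat
      by (intro sets.finite_UN) auto
    have UA [measurable]: "(\<Union>i. A i) \<in> sets (M1 \<Otimes>\<^sub>M M2)"
      by (intro sets.countable_UN) auto
    have "(\<lambda>k. ?I (\<Union>i<k. A i)) \<longlonglongrightarrow> ?I (\<Union>i. A i)"
    proof (rule integral_dominated_convergence)
      show "integrable Q (\<lambda>x. norm (g x))" using g by simp
      show "AE x in Q. (\<lambda>k. g x * indicator (\<Union>i<k. A i) (\<xi> x, \<eta> x)) \<longlonglongrightarrow> g x * indicator (\<Union>i. A i) (\<xi> x, \<eta> x)"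
        by (intro AE_I2 tendsto_mult tendsto_const LIMSEQ_indicator_UN)
      show "(\<lambda>x. g x * indicator (\<Union>i. A i) (\<xi> x, \<eta> x)) \<in> borel_measurable Q"
        by (rule borel_measurable_integrable[OF int[OF UA]])
      show "(\<lambda>x. g x * indicator (\<Union>i<k. A i) (\<xi> x, \<eta> x)) \<in> borel_measurable Q" for k :: nat
        by (rule borel_measurable_integrable[OF int[OF B]])
      show "AE x in Q. norm (g x * indicator (\<Union>i<k. A i) (\<xi> x, \<eta> x)) \<le> norm (g x)" for k :: nat
        by (rule AE_I2) (simp add: norm_mult indicator_def)
    qed
    moreover have "?I (\<Union>i<k. A i) = 0" for k
    proof (induction k)
      case (Suc k)
      have "A k \<inter> (\<Union>i<k. A i) = {}"
        using disjoint_family_onD[OF union.hyps(1), of k] by (force simp: disjoint_iff)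
      then have "?I (\<Union>i<Suc k. A i) = (\<integral>x. g x * indicator (A k) (\<xi> x, \<eta> x) + g x * indicator (\<Union>i<k. A i) (\<xi> x, \<eta> x) \<partial>Q)"
        by (intro Bochner_Integration.integral_cong refl) (simp add: lessThan_Suc indicator_add[symmetric] distrib_left)
      also have "\<dots> = ?I (A k) + ?I (\<Union>i<k. A i)"
        by (rule Bochner_Integration.integral_add[OF int[OF A] int[OF B]])
      finally show ?case using Suc union.IH by simp
    qed simp
    ultimately show ?case by (simp add: LIMSEQ_const_iff)
  qed
qed


text \<open>Turns a term in the expansion of a product of sums, with \<open>f\<close> on
  \<open>E\<close> and \<open>g\<close> off \<open>E\<close>, into one product over a mixed
  family.\<close>

lemma prod_mix:
  assumes "E \<subseteq> A" "finite A"
  shows "(\<Prod>v\<in>E. \<alpha> v f) * (\<Prod>v\<in>A - E. \<alpha> v g) = (\<Prod>v\<in>A. \<alpha> v (if v \<in> E then f else g) :: 'b::comm_monoid_mult)"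
proof -
  have "(\<Prod>v\<in>A. \<alpha> v (if v \<in> E then f else g)) =
        (\<Prod>v\<in>A - E. \<alpha> v (if v \<in> E then f else g)) * (\<Prod>v\<in>E. \<alpha> v (if v \<in> E then f else g))"
    using assms by (rule prod.subset_diff)
  then show ?thesis by (simp add: mult.commute)
qed

lemma funpow_cnj_indicator [simp]: "(cnj ^^ k) (indicator A x) = indicator A x"
  by (induction k) (auto simp: indicator_def)

lemma funpow_cnj_1 [simp]: "(cnj ^^ k) 1 = 1"
  by (induction k) auto

section \<open>The Gowers-Cauchy-Schwarz inequality and the seminorm\<close>

context invariant_probability
begin
text \<open>If both faces carry the same functions, the two factors in
  \<open>gowers_form_faces\<close> are conjugate to each other. All nonnegativity comes from
  here.\<close>

lemma gowers_form_face_self: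
  assumes F: "\<And>v. v \<in> cube n \<Longrightarrow> F v \<in> bounded_measurable" and i: "i \<in> {1..n}" and k: "k \<in> {0, 1}"
  shows "gowers_form n (face i k F) =
           of_real (\<integral>c. (cmod (face_integral n i (face i k F) c))\<^sup>2 \<partial>(\<Pi>\<^sub>M j\<in>{1..n} - {i}. M))"
proof -
  have "gowers_form n (face i k F) = (\<integral>c. face_integral n i (face i 0 (face i k F)) c *
          cnj (face_integral n i (face i 1 (face i k F)) c) \<partial>(\<Pi>\<^sub>M j\<in>{1..n} - {i}. M))"
    by (rule gowers_form_faces[OF _ i]) (use F i k fun_upd_cube in blast)
  also have "\<dots> = (\<integral>c. of_real ((cmod (face_integral n i (face i k F) c))\<^sup>2) \<partial>(\<Pi>\<^sub>M j\<in>{1..n} - {i}. M))"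
    by (simp only: fun_upd_upd complex_norm_square)
  also have "\<dots> = of_real (\<integral>c. (cmod (face_integral n i (face i k F) c))\<^sup>2 \<partial>(\<Pi>\<^sub>M j\<in>{1..n} - {i}. M))"
    by (rule integral_complex_of_real)
  finally show ?thesis .
qed

text \<open>Cauchy-Schwarz in the coordinates other than \<open>0\<close> and \<open>i\<close>;
  \<open>gowers_form_face_self\<close> identifies the two square integrals as forms again.\<close>

lemma gowers_form_Cauchy_Schwarz:
  assumes F: "\<And>v. v \<in> cube n \<Longrightarrow> F v \<in> bounded_measurable" and i: "i \<in> {1..n}"
  shows "(cmod (gowers_form n F))\<^sup>2 \<le>
           cmod (gowers_form n (face i 0 F)) * cmod (gowers_form n (face i 1 F))"
proof -
  let ?Q = "\<Pi>\<^sub>M j\<in>{1..n} - {i}. M"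
  interpret Q: prob_space ?Q by (rule prob_space_PiM_M)
  have F': "face i k F v \<in> bounded_measurable" if "v \<in> cube n" "k \<in> {0, 1}" for v k
    using F fun_upd_cube i that by blast
  have m: "face_integral n i (face i k F) \<in> borel_measurable ?Q" if "k \<in> {0, 1}" for k
    using F' i that by (intro measurable_face_integral) (auto intro: bounded_measurableD)
  obtain C where C: "\<And>c. c \<in> space ?Q \<Longrightarrow> cmod (face_integral n i (face i 0 F) c) \<le> C"
    by (rule face_integral_bound[of n "face i 0 F" i]) (use F' i in auto)
  obtain D where D: "\<And>c. c \<in> space ?Q \<Longrightarrow> cmod (face_integral n i (face i 1 F) c) \<le> D"
    by (rule face_integral_bound[of n "face i 1 F" i]) (use F' i in auto)
  have self: "cmod (gowers_form n (face i k F)) = (\<integral>c. (cmod (face_integral n i (face i k F) c))\<^sup>2 \<partial>?Q)"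
    if k: "k \<in> {0, 1}" for k
  proof -
    have "0 \<le> (\<integral>c. (cmod (face_integral n i (face i k F) c))\<^sup>2 \<partial>?Q)" by simp
    moreover have "gowers_form n (face i k F) = of_real (\<integral>c. (cmod (face_integral n i (face i k F) c))\<^sup>2 \<partial>?Q)"
      by (rule gowers_form_face_self[OF F i k])
    ultimately show ?thesis by (simp only: norm_of_real abs_of_nonneg)
  qed
  have "(cmod (gowers_form n F))\<^sup>2 =
      (cmod (\<integral>c. face_integral n i (face i 0 F) c * cnj (face_integral n i (face i 1 F) c) \<partial>?Q))\<^sup>2"
    by (simp only: gowers_form_faces[OF F i])
  also have "\<dots> \<le> (\<integral>c. (cmod (face_integral n i (face i 0 F) c))\<^sup>2 \<partial>?Q) *
      (\<integral>c. (cmod (face_integral n i (face i 1 F) c))\<^sup>2 \<partial>?Q)"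
    by (rule Q.Cauchy_Schwarz_integral[OF m m C D]) auto
  also have "\<dots> = cmod (gowers_form n (face i 0 F)) * cmod (gowers_form n (face i 1 F))"
    by (simp only: self insert_iff simp_thms)
  finally show ?thesis .
qed

text \<open>One application of Cauchy-Schwarz for each direction in \<open>S\<close>. It squares the
  left side and replaces each factor by two, in which that direction is frozen to \<open>0\<close>
  and to \<open>1\<close>.\<close>

lemma gowers_form_override:
  assumes F: "\<And>v. v \<in> cube n \<Longrightarrow> F v \<in> bounded_measurable" and S: "S \<subseteq> {1..n}"
  shows "cmod (gowers_form n F) ^ 2 ^ card S \<le>
           (\<Prod>u\<in>S \<rightarrow>\<^sub>E {0, 1}. cmod (gowers_form n (\<lambda>v. F (\<lambda>j. if j \<in> S then u j else v j))))"
proof -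
  have "finite S" using S finite_subset by blast
  then show ?thesis using S
  proof (induction S rule: finite_induct)
    case empty
    then show ?case by simp
  next
    case (insert i S)
    define G where "G u = (\<lambda>v. F (\<lambda>j. if j \<in> S then u j else v j))" for u
    have i: "i \<in> {1..n}" and S: "S \<subseteq> {1..n}" using insert.prems by auto
    have G: "G u v \<in> bounded_measurable" if "u \<in> S \<rightarrow>\<^sub>E {0, 1}" "v \<in> cube n" for u v
      unfolding G_def using that S by (intro F) (auto simp: cube_def PiE_iff extensional_def)
    \<comment> \<open>Since \<open>i \<notin> S\<close>, freezing direction \<open>i\<close>
      commutes with the freezing on \<open>S\<close>.\<close>
    have upd: "(\<lambda>v. F (\<lambda>j. if j \<in> insert i S then (u(i := k)) j else v j)) = face i k (G u)" for u k
    proof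
      fix v
      have "(\<lambda>j. if j \<in> insert i S then (u(i := k)) j else v j) = (\<lambda>j. if j \<in> S then u j else (v(i := k)) j)"
        using \<open>i \<notin> S\<close> by (auto simp: fun_eq_iff)
      then show "F (\<lambda>j. if j \<in> insert i S then (u(i := k)) j else v j) = face i k (G u) v"
        by (simp only: G_def)
    qed
    have "cmod (gowers_form n F) ^ 2 ^ card (insert i S) = (cmod (gowers_form n F) ^ 2 ^ card S)\<^sup>2"
      using insert.hyps by (simp add: power_mult mult.commute[of 2])
    also have "\<dots> \<le> (\<Prod>u\<in>S \<rightarrow>\<^sub>E {0, 1}. cmod (gowers_form n (G u)))\<^sup>2"
      unfolding G_def by (intro power_mono insert.IH[OF S]) auto
    also have "\<dots> = (\<Prod>u\<in>S \<rightarrow>\<^sub>E {0, 1}. (cmod (gowers_form n (G u)))\<^sup>2)"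
      by (rule prod_power_distrib)
    finally have le: "cmod (gowers_form n F) ^ 2 ^ card (insert i S) \<le>
        (\<Prod>u\<in>S \<rightarrow>\<^sub>E {0, 1}. (cmod (gowers_form n (G u)))\<^sup>2)" .
    have CS: "(cmod (gowers_form n (G u)))\<^sup>2 \<le> cmod (gowers_form n (face i 0 (G u))) * cmod (gowers_form n (face i 1 (G u)))"
      if "u \<in> S \<rightarrow>\<^sub>E {0, 1}" for u
      by (rule gowers_form_Cauchy_Schwarz) (use G that i in auto)
    note le
    also have "(\<Prod>u\<in>S \<rightarrow>\<^sub>E {0, 1}. (cmod (gowers_form n (G u)))\<^sup>2) \<le> (\<Prod>u\<in>S \<rightarrow>\<^sub>E {0, 1}. cmod (gowers_form n (face i 0 (G u))) * cmod (gowers_form n (face i 1 (G u))))"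
      by (intro prod_mono conjI CS) auto
    also have "\<dots> = (\<Prod>u\<in>insert i S \<rightarrow>\<^sub>E {0, 1}. cmod (gowers_form n (\<lambda>v. F (\<lambda>j. if j \<in> insert i S then u j else v j))))"
      unfolding cube_override_insert[OF insert.hyps(2,1)] upd ..
    finally show ?case .
  qed
qed

text \<open>Once every direction is frozen, the family no longer depends on \<open>v\<close> and
  carries a single \<open>F u\<close> at all vertices.\<close>

theorem gowers_Cauchy_Schwarz:
  assumes F: "\<And>v. v \<in> cube n \<Longrightarrow> F v \<in> bounded_measurable"
  shows "cmod (gowers_form n F) ^ 2 ^ n \<le> (\<Prod>u\<in>cube n. cmod (gowers_form n (\<lambda>v. F u)))"
proof -
  have "gowers_form n (\<lambda>v. F (\<lambda>j. if j \<in> {1..n} then u j else v j)) = gowers_form n (\<lambda>v. F u)"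
    if u: "u \<in> cube n" for u
  proof (rule gowers_form_cong)
    fix v assume "v \<in> cube n"
    then have "(\<lambda>j. if j \<in> {1..n} then u j else v j) = u"
      using u by (auto simp: cube_def PiE_iff extensional_def fun_eq_iff)
    then show "F (\<lambda>j. if j \<in> {1..n} then u j else v j) = F u" by simp
  qed
  then have "(\<Prod>u\<in>cube n. cmod (gowers_form n (\<lambda>v. F (\<lambda>j. if j \<in> {1..n} then u j else v j)))) =
        (\<Prod>u\<in>cube n. cmod (gowers_form n (\<lambda>v. F u)))"
    by (intro prod.cong) auto
  moreover have "cmod (gowers_form n F) ^ 2 ^ card {1..n} \<le>
      (\<Prod>u\<in>{1..n} \<rightarrow>\<^sub>E {0, 1}. cmod (gowers_form n (\<lambda>v. F (\<lambda>j. if j \<in> {1..n} then u j else v j))))"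
    by (rule gowers_form_override) (use F in auto)
  ultimately show ?thesis
    by (simp add: cube_def)
qed

text \<open>A constant family is its own copy of a face; \<open>1 \<le> n\<close> supplies direction
  \<open>1\<close>.\<close>

lemma gowers_form_nonneg:
  assumes f: "f \<in> bounded_measurable" and n: "1 \<le> n"
  shows "gowers_form n (\<lambda>v. f) = of_real (cmod (gowers_form n (\<lambda>v. f)))"
  using gowers_form_face_self[of n "\<lambda>v. f" 1 0] assms by simp

text \<open>The modulus stands for the real part in \<open>gowers_norm\<close>, which makes
  nonnegativity immediate; the two agree by \<open>gowers_form_nonneg\<close>.\<close>

definition unorm :: "nat \<Rightarrow> ('a \<Rightarrow> complex) \<Rightarrow> real" where
  "unorm n f = root (2 ^ n) (cmod (gowers_form n (\<lambda>v. f)))"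

lemma unorm_nonneg: "0 \<le> unorm n f"
  by (simp add: unorm_def)

lemma unorm_power: "unorm n f ^ 2 ^ n = cmod (gowers_form n (\<lambda>v. f))"
  by (simp add: unorm_def)

lemma card_cube: "card (cube n) = 2 ^ n"
  by (simp add: cube_def card_PiE numeral_2_eq_2)

lemma gowers_form_le_unorm:
  assumes F: "\<And>v. v \<in> cube n \<Longrightarrow> F v \<in> bounded_measurable"
  shows "cmod (gowers_form n F) \<le> (\<Prod>u\<in>cube n. unorm n (F u))"
proof -
  have "cmod (gowers_form n F) ^ 2 ^ n \<le> (\<Prod>u\<in>cube n. unorm n (F u)) ^ 2 ^ n"
    using gowers_Cauchy_Schwarz[OF F] by (simp add: prod_power_distrib unorm_power)
  then show ?thesis
    by (rule power_le_imp_le_base[of _ "2 ^ n - 1", simplified]) (auto intro!: prod_nonneg unorm_nonneg)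
qed

lemma unorm_cmult:
  assumes n: "1 \<le> n"
  shows "unorm n (\<lambda>x. c * f x) = cmod c * unorm n f"
proof -
  have "gowers_form n (\<lambda>v x. c * f x) = (\<Prod>v\<in>cube n. (cnj ^^ (\<Sum>i=1..n. v i)) c) * gowers_form n (\<lambda>v. f)"
    by (simp add: gowers_form_def gowers_kernel_def funpow_cnj_mult prod.distrib)
  then have "cmod (gowers_form n (\<lambda>v x. c * f x)) = cmod c ^ 2 ^ n * cmod (gowers_form n (\<lambda>v. f))"
    by (simp add: norm_mult prod_norm[symmetric] card_cube)
  then show ?thesis
    by (simp add: unorm_def real_root_mult real_root_power_cancel)
qed

lemma bounded_measurable_add:
  assumes "f \<in> bounded_measurable" "g \<in> bounded_measurable"
  shows "(\<lambda>x. f x + g x) \<in> bounded_measurable"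
proof -
  obtain C D where "\<And>x. cmod (f x) \<le> C" "\<And>x. cmod (g x) \<le> D"
    using bounded_measurable_bound assms by metis
  then have "cmod (f x + g x) \<le> C + D" for x
    by (meson add_mono norm_triangle_le)
  then show ?thesis
    using assms unfolding bounded_measurable_def bounded_iff by auto
qed

text \<open>The product of sums is expanded over the set \<open>E\<close> of vertices that carry
  \<open>f\<close>. Each mixed form is at most the product of the seminorms of its entries, and
  these bounds add up to the expansion of \<open>(unorm n f + unorm n g) ^ 2 ^ n\<close>.\<close>

lemma unorm_triangle:
  assumes f: "f \<in> bounded_measurable" and g: "g \<in> bounded_measurable" and n: "1 \<le> n"
  shows "unorm n (\<lambda>x. f x + g x) \<le> unorm n f + unorm n g"
proof -
  define mix where "mix E v = (if v \<in> E then f else g)" for E :: "(nat \<Rightarrow> nat) set" and v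
  have mix: "mix E v \<in> bounded_measurable" for E v
    using f g by (simp add: mix_def)
  have "gowers_kernel n (\<lambda>v x. f x + g x) a = (\<Sum>E\<in>Pow (cube n). gowers_kernel n (mix E) a)" for a
  proof -
    have "gowers_kernel n (\<lambda>v x. f x + g x) a = (\<Sum>E\<in>Pow (cube n).
        (\<Prod>v\<in>E. (cnj ^^ (\<Sum>i=1..n. v i)) (f (cube_point n a v))) *
        (\<Prod>v\<in>cube n - E. (cnj ^^ (\<Sum>i=1..n. v i)) (g (cube_point n a v))))"
      unfolding gowers_kernel_def funpow_cnj_add by (rule prod_add) simp
    also have "\<dots> = (\<Sum>E\<in>Pow (cube n). gowers_kernel n (mix E) a)"
      unfolding gowers_kernel_def
      using prod_mix[of _ "cube n" "\<lambda>v f. (cnj ^^ (\<Sum>i=1..n. v i)) (f (cube_point n a v))" f g]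
      by (intro sum.cong) (auto simp: mix_def)
    finally show ?thesis .
  qed
  then have "gowers_form n (\<lambda>v x. f x + g x) = (\<integral>a. (\<Sum>E\<in>Pow (cube n). gowers_kernel n (mix E) a) \<partial>P n)"
    unfolding gowers_form_def by presburger
  also have "\<dots> = (\<Sum>E\<in>Pow (cube n). gowers_form n (mix E))"
    unfolding gowers_form_def by (rule Bochner_Integration.integral_sum) (rule integrable_gowers_kernel, rule mix)
  finally have "gowers_form n (\<lambda>v x. f x + g x) = (\<Sum>E\<in>Pow (cube n). gowers_form n (mix E))" .
  then have "cmod (gowers_form n (\<lambda>v x. f x + g x)) \<le> (\<Sum>E\<in>Pow (cube n). cmod (gowers_form n (mix E)))"
    by (simp add: norm_sum)
  also have "\<dots> \<le> (\<Sum>E\<in>Pow (cube n). \<Prod>u\<in>cube n. unorm n (mix E u))"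
    by (intro sum_mono gowers_form_le_unorm mix)
  also have "\<dots> = (\<Sum>E\<in>Pow (cube n). (\<Prod>v\<in>E. unorm n f) * (\<Prod>v\<in>cube n - E. unorm n g))"
    using prod_mix[of _ "cube n" "\<lambda>v. unorm n" f g] by (intro sum.cong) (auto simp: mix_def)
  also have "\<dots> = (\<Prod>v\<in>cube n. unorm n f + unorm n g)"
    by (rule prod_add[symmetric]) simp
  also have "\<dots> = (unorm n f + unorm n g) ^ 2 ^ n"
    by (simp add: card_cube)
  finally have "unorm n (\<lambda>x. f x + g x) ^ 2 ^ n \<le> (unorm n f + unorm n g) ^ 2 ^ n"
    by (simp add: unorm_power)
  then show ?thesis
    by (rule power_le_imp_le_base[of _ "2 ^ n - 1", simplified]) (auto intro!: add_nonneg_nonneg unorm_nonneg)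
qed


text \<open>In the face coordinates of direction \<open>1\<close> the vertex is a free variable
  \<open>a k\<close>, with \<open>k\<close> equal to \<open>0\<close> or \<open>1\<close>, followed
  by a term without \<open>a k\<close>; right invariance absorbs that term. Hence null sets of
  \<open>M\<close> pull back to null sets of cubes.\<close>

lemma distr_cube_point:
  assumes n: "1 \<le> n"
  shows "distr (P n) M (\<lambda>a. cube_point n a v) = M"
proof (rule measure_eqI)
  interpret product_sigma_finite "\<lambda>i. M" by (rule product_sigma_finite)
  fix A assume "A \<in> sets (distr (P n) M (\<lambda>a. cube_point n a v))"
  then have A [measurable]: "A \<in> sets M" by simp
  define k where "k = (if v 1 = 0 then 0 else 1 :: nat)"
  define J where "J = {0..n} - {k}"
  have J: "finite J" "k \<notin> J" "{0..n} = insert k J" "{2..n} \<subseteq> J" "k \<le> 1"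
    using n by (auto simp: J_def k_def)
  have "cube_point n (face_coords n 1 a) v = a k + seg a v 2 (Suc n)" for a
    using cube_point_face_coords[of 1 n a v] n by (simp add: k_def seg_def numeral_2_eq_2)
  note eq = this
  have s: "seg (b(k := y)) v 2 (Suc n) = seg b v 2 (Suc n)" for b y
    using J(5) by (intro seg_cong) auto
  have [measurable]: "(\<lambda>a. a k + seg a v 2 (Suc n)) \<in> P n \<rightarrow>\<^sub>M M"
    using n by (intro measurable_add measurable_seg measurable_component_singleton) (auto simp: k_def)
  have m: "(\<lambda>a. indicator A (a k + seg a v 2 (Suc n)) :: ennreal) \<in> borel_measurable (P n)"
    by measurable
  have "emeasure (distr (P n) M (\<lambda>a. cube_point n a v)) A = (\<integral>\<^sup>+a. indicator A (cube_point n a v) \<partial>P n)"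
    by (subst nn_integral_indicator[symmetric], simp, subst nn_integral_distr) auto
  also have "\<dots> = (\<integral>\<^sup>+a. indicator A (cube_point n a v) \<partial>distr (P n) (P n) (face_coords n 1))"
    using n by (simp only: distr_face_coords)
  also have "\<dots> = (\<integral>\<^sup>+a. indicator A (a k + seg a v 2 (Suc n)) \<partial>P n)"
    using n by (subst nn_integral_distr) (auto simp: eq simp del: One_nat_def)
  also have "\<dots> = (\<integral>\<^sup>+b. \<integral>\<^sup>+y. indicator A (y + seg b v 2 (Suc n)) \<partial>M \<partial>(\<Pi>\<^sub>M j\<in>J. M))"
    using m unfolding J(3) by (subst product_nn_integral_insert[OF J(1,2)]) (auto simp: s)
  also have "\<dots> = (\<integral>\<^sup>+b. emeasure M A \<partial>(\<Pi>\<^sub>M j\<in>J. M))"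
    using nn_integral_plus_right[of "indicator A"] by (simp add: A)
  also have "\<dots> = emeasure M A"
    using prob_space.emeasure_space_1[OF prob_space_PiM_M[of J]] by simp
  finally show "emeasure (distr (P n) M (\<lambda>a. cube_point n a v)) A = emeasure M A" .
qed simp

lemma AE_cube_point:
  assumes "AE x in M. Q x" "1 \<le> n"
  shows "AE a in P n. Q (cube_point n a v)"
  using AE_distrD[OF measurable_cube_point, of Q n v] assms(1)
  unfolding distr_cube_point[OF assms(2)] by blast

lemma unorm_cong_AE:
  assumes f: "f \<in> bounded_measurable" and g: "g \<in> bounded_measurable" and ae: "AE x in M. f x = g x" and n: "1 \<le> n"
  shows "unorm n f = unorm n g"
proof -
  have "AE a in P n. \<forall>v\<in>cube n. f (cube_point n a v) = g (cube_point n a v)"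
    using AE_cube_point[OF ae n] by (intro AE_finite_allI) auto
  then have "AE a in P n. gowers_kernel n (\<lambda>v. f) a = gowers_kernel n (\<lambda>v. g) a"
    by eventually_elim (simp add: gowers_kernel_def)
  then have "gowers_form n (\<lambda>v. f) = gowers_form n (\<lambda>v. g)"
    unfolding gowers_form_def using f g
    by (intro integral_cong_AE measurable_gowers_kernel) (auto intro: bounded_measurableD)
  then show ?thesis by (simp add: unorm_def)
qed


section \<open>Definiteness of the seminorm\<close>

lemma seg_Cons: "k < l \<Longrightarrow> seg a v k l = (if v k = 0 then 0 else a k) + seg a v (Suc k) l"
  by (simp add: seg_def upt_rec)

lemma seg_eq_0: "(\<And>j. k \<le> j \<Longrightarrow> j < l \<Longrightarrow> v j = 0) \<Longrightarrow> seg a v k l = 0"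
proof -
  assume "\<And>j. k \<le> j \<Longrightarrow> j < l \<Longrightarrow> v j = 0"
  then have "seg a v k l = sum_list (map (\<lambda>i. 0) [k..<l])"
    unfolding seg_def by (intro arg_cong[where f = sum_list] map_cong) auto
  then show ?thesis by simp
qed


lemma bounded_measurable_indicator: "A \<in> sets M \<Longrightarrow> indicator A \<in> bounded_measurable"
  by (auto simp: bounded_measurable_def bounded_iff indicator_def intro!: exI[of _ 1])

lemma bounded_measurable_const: "(\<lambda>x. c) \<in> bounded_measurable"
  by (auto simp: bounded_measurable_def bounded_iff)

text \<open>This is a Gowers form with \<open>f\<close> at one vertex, indicators at the other three
  vertices of the face spanned by directions \<open>1\<close> and \<open>2\<close>, and the constant
  \<open>1\<close> elsewhere. Its bound contains the factor \<open>unorm n f = 0\<close>.\<close>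

lemma integral_corner_eq_0:
  assumes f: "f \<in> bounded_measurable" and n: "2 \<le> n" and norm: "unorm n f = 0"
    and A: "A \<in> sets M" and B: "B \<in> sets M" and C: "C \<in> sets M"
  shows "(\<integral>a. f (a 0) * indicator A (a 0 + a 1) * indicator B (a 0 + a 2) * indicator C (a 0 + a 1 + a 2) \<partial>P n) = 0"
proof -
  define v00 where "v00 = (\<lambda>j\<in>{1..n}. 0 :: nat)"
  define v10 where "v10 = v00(1 := 1)"
  define v01 where "v01 = v00(2 := 1)"
  define v11 where "v11 = v10(2 := 1)"
  define F where "F v = (if v = v00 then f else if v = v10 then indicator A
      else if v = v01 then indicator B else if v = v11 then indicator C else (\<lambda>x. 1))" for v
  have vals: "v00 1 = 0" "v00 2 = 0" "v10 1 = 1" "v10 2 = 0" "v01 1 = 0" "v01 2 = 1" "v11 1 = 1" "v11 2 = 1"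
    using n by (simp_all add: v00_def v10_def v01_def v11_def)
  have ne: "v10 \<noteq> v00" "v01 \<noteq> v00" "v11 \<noteq> v00" "v01 \<noteq> v10" "v11 \<noteq> v10" "v11 \<noteq> v01"
    using vals by auto
  have v00: "v00 \<in> cube n" by (auto simp: v00_def cube_def)
  have v10: "v10 \<in> cube n" unfolding v10_def using n by (intro fun_upd_cube v00) auto
  have v01: "v01 \<in> cube n" unfolding v01_def using n by (intro fun_upd_cube v00) auto
  have v11: "v11 \<in> cube n" unfolding v11_def using n by (intro fun_upd_cube v10) auto
  have F: "F v \<in> bounded_measurable" for v
    using f A B C by (auto simp: F_def intro: bounded_measurable_indicator bounded_measurable_const)
  have tail: "\<forall>j\<ge>3. j < Suc n \<longrightarrow> v00 j = 0" "\<forall>j\<ge>3. j < Suc n \<longrightarrow> v10 j = 0"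
    "\<forall>j\<ge>3. j < Suc n \<longrightarrow> v01 j = 0" "\<forall>j\<ge>3. j < Suc n \<longrightarrow> v11 j = 0"
    by (simp_all add: v00_def v10_def v01_def v11_def)
  have pt: "cube_point n a v = a 0 + ((if v 1 = 0 then 0 else a 1) + (if v 2 = 0 then 0 else a 2))"
    if v: "\<forall>j\<ge>3. j < Suc n \<longrightarrow> v j = 0" for a :: "nat \<Rightarrow> 'a" and v
  proof -
    have "seg a v 1 (Suc n) = (if v 1 = 0 then 0 else a 1) + seg a v (Suc 1) (Suc n)"
      by (rule seg_Cons) (use n in simp)
    also have "seg a v (Suc 1) (Suc n) = (if v 2 = 0 then 0 else a 2) + seg a v (Suc 2) (Suc n)"
      unfolding Suc_1 by (rule seg_Cons) (use n in simp)
    also have "seg a v (Suc 2) (Suc n) = 0"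
      by (rule seg_eq_0) (use v in simp)
    finally show ?thesis by (simp only: cube_point_seg add_0_right)
  qed
  have pts: "cube_point n a v00 = a 0" "cube_point n a v10 = a 0 + a 1"
    "cube_point n a v01 = a 0 + a 2" "cube_point n a v11 = a 0 + a 1 + a 2" for a :: "nat \<Rightarrow> 'a"
    unfolding pt[OF tail(1)] pt[OF tail(2)] pt[OF tail(3)] pt[OF tail(4)]
    by (simp_all add: vals add.assoc del: One_nat_def)
  have "gowers_kernel n F a = f (a 0) * indicator A (a 0 + a 1) * indicator B (a 0 + a 2) * indicator C (a 0 + a 1 + a 2)" for a
  proof -
    let ?J = "\<lambda>v. (cnj ^^ (\<Sum>i=1..n. v i)) (F v (cube_point n a v))"
    have Fs: "F v00 = f" "F v10 = indicator A" "F v01 = indicator B" "F v11 = indicator C"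
      using ne by (simp_all add: F_def)
    have "gowers_kernel n F a = (\<Prod>v\<in>{v00, v10, v01, v11}. ?J v)"
      unfolding gowers_kernel_def
    proof (rule prod.mono_neutral_right)
      show "\<forall>v\<in>cube n - {v00, v10, v01, v11}. ?J v = 1"
        by (simp add: F_def)
    qed (use v00 v10 v01 v11 in auto)
    also have "\<dots> = ?J v00 * (?J v10 * (?J v01 * ?J v11))"
      using ne ne[symmetric] by simp
    \<comment> \<open>At the vertex of \<open>f\<close> there is no conjugation; the other three
      factors are real, so conjugation leaves them alone.\<close>
    also have "(\<Sum>i=1..n. v00 i) = 0" by (simp add: v00_def)
    then have "?J v00 * (?J v10 * (?J v01 * ?J v11)) =
        f (a 0) * indicator A (a 0 + a 1) * indicator B (a 0 + a 2) * indicator C (a 0 + a 1 + a 2)"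
      by (simp only: Fs pts funpow_cnj_indicator funpow_0 mult.assoc)
    finally show ?thesis .
  qed
  then have "(\<integral>a. f (a 0) * indicator A (a 0 + a 1) * indicator B (a 0 + a 2) * indicator C (a 0 + a 1 + a 2) \<partial>P n) = gowers_form n F"
    by (simp only: gowers_form_def)
  moreover have "cmod (gowers_form n F) \<le> (\<Prod>u\<in>cube n. unorm n (F u))"
    by (rule gowers_form_le_unorm) (rule F)
  moreover have "F v00 = f" by (simp add: F_def)
  then have "(\<Prod>u\<in>cube n. unorm n (F u)) = 0"
    using v00 norm by (intro prod_zero[OF finite_cube]) metis
  ultimately show ?thesis by (simp only: norm_le_zero_iff)
qed

text \<open>
  The vanishing of the integral in the previous lemma extends from boxes to all measurable sets of
  triples \<open>(a 0 + a 1, a 0 + a 2, a 0 + a 1 + a 2)\<close>, and such a triple determines \<open>a 0\<close>.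
\<close>

lemma unorm_eq_0_imp_AE:
  assumes f: "f \<in> bounded_measurable" and n: "2 \<le> n" and norm: "unorm n f = 0"
  shows "AE x in M. f x = 0"
proof (rule density_zero)
  obtain C where C: "\<And>x. cmod (f x) \<le> C"
    using bounded_measurable_bound[OF f] by metis
  note [measurable] = bounded_measurableD[OF f]
  show "integrable M f" by (rule integrable_bounded[of _ C]) (auto intro: C)
  interpret Pn: prob_space "P n" by (rule prob_space_PiM_M)
  fix D assume D [measurable]: "D \<in> sets M"
  have a [measurable]: "(\<lambda>a. a 0) \<in> P n \<rightarrow>\<^sub>M M" "(\<lambda>a. a 1) \<in> P n \<rightarrow>\<^sub>M M" "(\<lambda>a. a 2) \<in> P n \<rightarrow>\<^sub>M M"
    using n by (auto intro!: measurable_component_singleton)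
  have pts [measurable]: "(\<lambda>a. a 0 + a 1) \<in> P n \<rightarrow>\<^sub>M M" "(\<lambda>a. a 0 + a 2) \<in> P n \<rightarrow>\<^sub>M M"
    "(\<lambda>a. a 0 + a 1 + a 2) \<in> P n \<rightarrow>\<^sub>M M"
    by (intro measurable_add a)+
  have int: "integrable (P n) (\<lambda>a. f (a 0) * indicator S (a 0 + a 1 + a 2))" if S [measurable]: "S \<in> sets M" for S
  proof (rule Pn.integrable_bounded[of _ C])
    show "cmod (f (a 0) * indicator S (a 0 + a 1 + a 2)) \<le> C" for a
      using C[of "a 0"] order_trans[OF norm_ge_zero C[of "a 0"]] by (auto simp: norm_mult indicator_def)
  qed measurable
  have int': "integrable (P n) (\<lambda>a. f (a 0))"
    by (rule Pn.integrable_bounded[of _ C], measurable) (rule C)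
  \<comment> \<open>A fixed set \<open>S\<close> for the third vertex lets the first two be extended
    to all measurable sets of pairs; fact \<open>2\<close> then frees the third.\<close>
  have 1: "(\<integral>a. (f (a 0) * indicator S (a 0 + a 1 + a 2)) * indicator E (a 0 + a 1, a 0 + a 2) \<partial>P n) = 0"
    if S: "S \<in> sets M" and E: "E \<in> sets (M \<Otimes>\<^sub>M M)" for S E
  proof (rule integral_indicator_pair_eq_0[OF int[OF S] pts(1,2) _ E])
    fix A B assume AB: "A \<in> sets M" "B \<in> sets M"
    have "(\<integral>a. (f (a 0) * indicator S (a 0 + a 1 + a 2)) * (indicator A (a 0 + a 1) * indicator B (a 0 + a 2)) \<partial>P n) =
      (\<integral>a. f (a 0) * indicator A (a 0 + a 1) * indicator B (a 0 + a 2) * indicator S (a 0 + a 1 + a 2) \<partial>P n)"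
      by (simp only: mult_ac)
    then show "(\<integral>a. (f (a 0) * indicator S (a 0 + a 1 + a 2)) * (indicator A (a 0 + a 1) * indicator B (a 0 + a 2)) \<partial>P n) = 0"
      by (simp only: integral_corner_eq_0[OF f n norm AB S])
  qed
  have 2: "(\<integral>a. f (a 0) * indicator E ((a 0 + a 1, a 0 + a 2), a 0 + a 1 + a 2) \<partial>P n) = 0"
    if E: "E \<in> sets ((M \<Otimes>\<^sub>M M) \<Otimes>\<^sub>M M)" for E
  proof (rule integral_indicator_pair_eq_0[OF int' measurable_Pair[OF pts(1,2)] pts(3) _ E])
    fix A S assume "A \<in> sets (M \<Otimes>\<^sub>M M)" "S \<in> sets M"
    then show "(\<integral>a. f (a 0) * (indicator A (a 0 + a 1, a 0 + a 2) * indicator S (a 0 + a 1 + a 2)) \<partial>P n) = 0"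
      using 1[of S A] by (simp only: mult_ac)
  qed
  \<comment> \<open>\<open>E\<close> is the preimage of \<open>D\<close> under the map that recovers
    the corner: \<open>(x + z) - (x + y + z) + (x + y) = x\<close>, where the order of the factors
    matters.\<close>
  define E where "E = {p \<in> space ((M \<Otimes>\<^sub>M M) \<Otimes>\<^sub>M M). snd (fst p) - snd p + fst (fst p) \<in> D}"
  have E: "E \<in> sets ((M \<Otimes>\<^sub>M M) \<Otimes>\<^sub>M M)" unfolding E_def by measurable
  have "(indicator E ((x + y, x + z), x + y + z) :: complex) = indicator D x" for x y z
  proof -
    have "x + z - (x + y + z) + (x + y) = x"
      by (simp add: diff_conv_add_uminus minus_add add.assoc del: add_uminus_conv_diff)
    then show ?thesis by (simp add: E_def indicator_def space_pair_measure)
  qed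
  then have "(\<integral>a. f (a 0) * indicator D (a 0) \<partial>P n) = 0"
    using 2[OF E] by simp
  then have "(\<integral>x. f x * indicator D x \<partial>distr (P n) M (\<lambda>a. a 0)) = 0"
    by (subst integral_distr) auto
  moreover have "distr (P n) M (\<lambda>a. a 0) = M"
    by (rule distr_PiM_component) (auto intro: prob_space_axioms)
  ultimately have "(\<integral>x. f x * indicator D x \<partial>M) = 0" by simp
  then show "set_lebesgue_integral M D f = 0"
    by (simp add: set_lebesgue_integral_def scaleR_conv_of_real of_real_indicator mult.commute)
qed

end

section \<open>Baire sets of a compact group\<close>

text \<open>The coarsest sigma-algebra that makes all continuous real functions measurable, since
  \<open>{x. c < \<phi> x}\<close> is the positivity set of \<open>\<phi> - c\<close>.\<close>

definition baire_algebra :: "'a::topological_space measure" where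
  "baire_algebra = sigma UNIV {{x. 0 < \<phi> x} | \<phi>. continuous_on UNIV (\<phi> :: 'a \<Rightarrow> real)}"

definition baire_measure :: "'a::topological_space measure \<Rightarrow> 'a measure" where
  "baire_measure \<mu> = restr_to_subalg \<mu> baire_algebra"

lemma space_baire_algebra [simp]: "space baire_algebra = UNIV"
  by (simp add: baire_algebra_def space_measure_of_conv)

lemma cozero_in_baire_algebra:
  assumes "continuous_on UNIV (\<phi> :: 'a::topological_space \<Rightarrow> real)"
  shows "{x. 0 < \<phi> x} \<in> sets baire_algebra"
  unfolding baire_algebra_def using assms by (auto simp: sets_measure_of_conv)

lemma baire_algebra_subset_borel: "sets (baire_algebra :: 'a::topological_space measure) \<subseteq> sets borel"
proof -
  have "{x. 0 < \<phi> x} \<in> sets borel" if "continuous_on UNIV \<phi>" for \<phi> :: "'a \<Rightarrow> real"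
    using that by (intro borel_open open_Collect_less) (auto intro: continuous_on_const)
  then show ?thesis
    unfolding baire_algebra_def
    by (simp add: sets_measure_of_conv) (intro sets.sigma_sets_subset[of _ borel, simplified], auto)
qed

text \<open>A form of uniform continuity without a metric on the group: the tube lemma yields one
  neighbourhood of \<open>x0\<close> that works for all \<open>y\<close>.\<close>

lemma compact_left_tube:
  fixes \<phi> :: "'a::topological_group_add \<Rightarrow> real"
  assumes comp: "compact (UNIV :: 'a set)" and \<phi>: "continuous_on UNIV \<phi>" and e: "0 < e"
  shows "\<exists>W. x0 \<in> W \<and> open W \<and> (\<forall>x\<in>W. \<forall>y. dist (\<phi> (x + y)) (\<phi> (x0 + y)) < e)"
proof -
  have c: "continuous_on UNIV (\<lambda>p. \<phi> (f p))" if "continuous_on UNIV f" for f :: "'a \<times> 'a \<Rightarrow> 'a"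
    using continuous_on_compose2[OF \<phi> that] by auto
  let ?W = "{p. dist (\<phi> (fst p + snd p)) (\<phi> (x0 + snd p)) < e}"
  have o: "open ?W"
    by (intro open_Collect_less continuous_on_dist c continuous_on_add continuous_on_fst continuous_on_snd
        continuous_on_const continuous_on_id)
  have sub: "{x0} \<times> UNIV \<subseteq> ?W"
    using e by auto
  obtain W where W: "x0 \<in> W" "open W" "W \<times> UNIV \<subseteq> ?W"
    using Elementary_Topology.tube_lemma[OF comp o sub] by blast
  have "dist (\<phi> (x + y)) (\<phi> (x0 + y)) < e" if "x \<in> W" for x y
    using subsetD[OF W(3), of "(x, y)"] that by simp
  then show ?thesis using W by blast
qed

text \<open>The supremum metric turns the translates into points of a metric space.
  \<open>Bcontfun\<close> takes its intended value because continuous functions on a compact group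
  are bounded.\<close>

definition translate_fun :: "('a::topological_group_add \<Rightarrow> real) \<Rightarrow> 'a \<Rightarrow> 'a \<Rightarrow>\<^sub>C real" where
  "translate_fun \<phi> x = Bcontfun (\<lambda>y. \<phi> (x + y))"

lemma continuous_translate:
  fixes \<phi> :: "'a::topological_group_add \<Rightarrow> real"
  assumes "continuous_on UNIV \<phi>"
  shows "continuous_on UNIV (\<lambda>y. \<phi> (x + y))"
  by (rule continuous_on_compose2[OF assms]) (auto intro: continuous_on_add continuous_on_const continuous_on_id)

lemma apply_translate_fun:
  fixes \<phi> :: "'a::topological_group_add \<Rightarrow> real"
  assumes comp: "compact (UNIV :: 'a set)" and \<phi>: "continuous_on UNIV \<phi>"
  shows "apply_bcontfun (translate_fun \<phi> x) y = \<phi> (x + y)"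
proof -
  have c: "continuous_on UNIV (\<lambda>y. \<phi> (x + y))" by (rule continuous_translate[OF \<phi>])
  have "bounded (range (\<lambda>y. \<phi> (x + y)))"
    using compact_continuous_image[OF c comp] by (rule compact_imp_bounded)
  then have "(\<lambda>y. \<phi> (x + y)) \<in> bcontfun" using c by (simp add: bcontfun_def)
  then show ?thesis by (simp add: translate_fun_def Bcontfun_inverse)
qed

lemma continuous_translate_fun:
  fixes \<phi> :: "'a::topological_group_add \<Rightarrow> real"
  assumes comp: "compact (UNIV :: 'a set)" and \<phi>: "continuous_on UNIV \<phi>"
  shows "continuous_on UNIV (translate_fun \<phi>)"
  unfolding continuous_on_def
proof (intro ballI tendstoI)
  fix x0 :: 'a and e :: real assume "0 < e"
  then obtain W where W: "x0 \<in> W" "open W" "\<And>x y. x \<in> W \<Longrightarrow> dist (\<phi> (x + y)) (\<phi> (x0 + y)) < e / 2"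
    using compact_left_tube[OF comp \<phi>, of "e / 2" x0] by auto
  have "dist (translate_fun \<phi> x) (translate_fun \<phi> x0) < e" if "x \<in> W" for x
  proof -
    have "dist (translate_fun \<phi> x) (translate_fun \<phi> x0) \<le> e / 2"
      using W(3)[OF that] by (intro dist_bound) (auto simp: apply_translate_fun[OF comp \<phi>] intro: less_imp_le)
    then show ?thesis using \<open>0 < e\<close> by simp
  qed
  then show "\<forall>\<^sub>F x in at x0 within UNIV. dist (translate_fun \<phi> x) (translate_fun \<phi> x0) < e"
    using W by (auto simp: eventually_at_topological)
qed

lemma dist_apply_translate_fun:
  fixes \<phi> :: "'a::topological_group_add \<Rightarrow> real"
  assumes comp: "compact (UNIV :: 'a set)" and \<phi>: "continuous_on UNIV \<phi>"
  shows "\<bar>\<phi> (x + z) - \<phi> (y + z)\<bar> \<le> dist (translate_fun \<phi> x) (translate_fun \<phi> y)"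
  using dist_bounded[of "translate_fun \<phi> x" z "translate_fun \<phi> y"]
  by (simp add: apply_translate_fun[OF comp \<phi>] dist_real_def)

text \<open>The right side says that \<open>x - y\<close> stabilises \<open>\<phi>\<close>, so the
  fibres of \<open>translate_fun \<phi>\<close> are cosets of the stabiliser.\<close>

lemma translate_fun_eq_iff:
  fixes \<phi> :: "'a::topological_group_add \<Rightarrow> real"
  assumes comp: "compact (UNIV :: 'a set)" and \<phi>: "continuous_on UNIV \<phi>"
  shows "translate_fun \<phi> x = translate_fun \<phi> y \<longleftrightarrow> (\<forall>z. \<phi> (x + z) = \<phi> (y + z))"
  by (metis apply_translate_fun[OF comp \<phi>] bcontfun_eqI)

text \<open>
  The translates of \<open>\<phi>\<close> form a compact metric space, so \<open>\<phi> (x + y)\<close> can be approximated uniformly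
  by functions that depend on \<open>x\<close> only through finitely many values; this replaces second
  countability.
\<close>

lemma measurable_plus_baire:
  assumes comp: "compact (UNIV :: 'a::topological_group_add set)"
  shows "(\<lambda>p. fst p + snd p) \<in> baire_algebra \<Otimes>\<^sub>M baire_algebra \<rightarrow>\<^sub>M (baire_algebra :: 'a measure)"
proof -
  have "(\<lambda>p. fst p + snd p) -` {x. 0 < \<phi> x} \<in> sets (baire_algebra \<Otimes>\<^sub>M baire_algebra)"
    if \<phi>: "continuous_on UNIV \<phi>" for \<phi> :: "'a \<Rightarrow> real"
  proof -
    let ?d = "\<lambda>x y. dist (translate_fun \<phi> x) (translate_fun \<phi> y)"
    have cd: "continuous_on UNIV (\<lambda>x. ?d x y)" for y
      by (intro continuous_on_dist continuous_translate_fun[OF comp \<phi>] continuous_on_const)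
    have "\<exists>F. finite F \<and> UNIV \<subseteq> (\<Union>y\<in>F. {x. ?d x y < e})" if "0 < e" for e
    proof -
      have "open {x. ?d x y < e}" for y
        by (intro open_Collect_less cd continuous_on_const)
      moreover have "UNIV \<subseteq> (\<Union>y. {x. ?d x y < e})" using that by auto
      ultimately show ?thesis
        using compactE_image[OF comp, of UNIV "\<lambda>y. {x. ?d x y < e}"] by (metis (lifting))
    qed
    then have "\<forall>n. \<exists>F. finite F \<and> UNIV \<subseteq> (\<Union>y\<in>F. {x. ?d x y < 1 / real (Suc n)})"
      by simp
    then obtain F where F: "\<And>n. finite (F n)" "\<And>n. UNIV \<subseteq> (\<Union>y\<in>F n. {x. ?d x y < 1 / real (Suc n)})"
      by metis
    \<comment> \<open>\<open>?d x y\<close> bounds, uniformly in \<open>z\<close>, the error of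
      replacing \<open>\<phi> (x + z)\<close> by \<open>\<phi> (y + z)\<close>; hence
      \<open>\<phi> (x + z)\<close> is positive on each rectangle.\<close>
    let ?A = "\<lambda>n y. {x. ?d x y < 1 / real (Suc n)} \<times> {z. 1 / real (Suc n) < \<phi> (y + z)}"
    have eq: "(\<lambda>p. fst p + snd p) -` {x. 0 < \<phi> x} = (\<Union>n. \<Union>y\<in>F n. ?A n y)"
    proof (intro equalityI subsetI)
      fix p assume "p \<in> (\<lambda>p. fst p + snd p) -` {x. 0 < \<phi> x}"
      then obtain x z where p: "p = (x, z)" "0 < \<phi> (x + z)" by (cases p) auto
      \<comment> \<open>The factor 2 leaves room for the error made when \<open>x\<close> is
        replaced by a centre \<open>y\<close>.\<close>
      obtain n where n: "1 / real (Suc n) < \<phi> (x + z) / 2"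
        using p(2) by (metis half_gt_zero reals_Archimedean inverse_eq_divide)
      obtain y where y: "y \<in> F n" "?d x y < 1 / real (Suc n)" using F(2)[of n] by blast
      have "1 / real (Suc n) < \<phi> (y + z)"
        using dist_apply_translate_fun[OF comp \<phi>, of x z y] y n by linarith
      then show "p \<in> (\<Union>n. \<Union>y\<in>F n. ?A n y)" using p y by auto
    next
      fix p assume "p \<in> (\<Union>n. \<Union>y\<in>F n. ?A n y)"
      then obtain n y x z where p: "p = (x, z)" "?d x y < 1 / real (Suc n)" "1 / real (Suc n) < \<phi> (y + z)"
        by auto
      then have "0 < \<phi> (x + z)"
        using dist_apply_translate_fun[OF comp \<phi>, of x z y] by linarith
      then show "p \<in> (\<lambda>p. fst p + snd p) -` {x. 0 < \<phi> x}" using p by simp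
    qed
    have "?A n y \<in> sets (baire_algebra \<Otimes>\<^sub>M baire_algebra)" for n y
    proof (rule pair_measureI)
      have "continuous_on UNIV (\<lambda>x. 1 / real (Suc n) - ?d x y)"
        by (intro continuous_on_diff continuous_on_const cd)
      from cozero_in_baire_algebra[OF this] show "{x. ?d x y < 1 / real (Suc n)} \<in> sets baire_algebra" by simp
      have "continuous_on UNIV (\<lambda>z. \<phi> (y + z) - 1 / real (Suc n))"
        by (intro continuous_on_diff continuous_on_const continuous_translate[OF \<phi>])
      from cozero_in_baire_algebra[OF this] show "{z. 1 / real (Suc n) < \<phi> (y + z)} \<in> sets baire_algebra" by simp
    qed
    then show ?thesis unfolding eq using F(1) by (intro sets.countable_UN sets.finite_UN image_subsetI) auto
  qed
  then show ?thesis
    unfolding baire_algebra_def[where 'a = 'a]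
    by (intro measurable_measure_of) (auto simp: space_pair_measure simp flip: baire_algebra_def)
qed

lemma measurable_uminus_baire: "uminus \<in> baire_algebra \<rightarrow>\<^sub>M (baire_algebra :: 'a::topological_group_add measure)"
proof -
  have "uminus -` {x. 0 < \<phi> x} \<in> sets (baire_algebra :: 'a measure)" if "continuous_on UNIV \<phi>" for \<phi> :: "'a \<Rightarrow> real"
  proof -
    have "continuous_on UNIV (\<lambda>x. \<phi> (- x))"
      by (rule continuous_on_compose2[OF that]) (auto intro: continuous_on_minus continuous_on_id)
    from cozero_in_baire_algebra[OF this] show ?thesis by (simp add: vimage_def)
  qed
  then show ?thesis
    unfolding baire_algebra_def[where 'a = 'a]
    by (intro measurable_measure_of) (auto simp flip: baire_algebra_def)
qed

section \<open>Separation by continuous functions\<close>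

lemma open_translate:
  fixes S :: "'a::topological_group_add set"
  assumes "open S"
  shows "open ((+) c ` S)"
proof -
  have "(+) c ` S = (\<lambda>z. - c + z) -` S"
    by (force simp: image_iff intro: exI[of _ "- c + _"])
  then show ?thesis
    using assms by (simp add: open_vimage continuous_on_add continuous_on_const continuous_on_id)
qed

text \<open>Continuity of \<open>a + s - t\<close> at \<open>(0, 0)\<close> keeps
  \<open>a + S - T\<close> away from \<open>C\<close>, so the neighbourhoods \<open>a + S\<close>
  and \<open>C + T\<close> are disjoint.\<close>

lemma regular_space_topological_group:
  "regular_space (euclidean :: 'a::topological_group_add topology)"
  unfolding regular_space_def
proof (intro allI impI, elim conjE)
  fix C :: "'a set" and a assume "closedin euclidean C" and a: "a \<in> topspace euclidean - C"
  then have C: "closed C" by simp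
  have "open ((\<lambda>p. a + fst p - snd p) -` (- C))"
    using C by (intro open_vimage) (auto intro!: continuous_intros)
  moreover have "(0, 0) \<in> (\<lambda>p. a + fst p - snd p) -` (- C)"
    using a by simp
  ultimately obtain S T where ST: "open S" "open T" "(0, 0) \<in> S \<times> T" "S \<times> T \<subseteq> (\<lambda>p. a + fst p - snd p) -` (- C)"
    by (rule open_prod_elim)
  let ?U = "(+) a ` S" and ?V = "\<Union>c\<in>C. (+) c ` T"
  have "disjnt ?U ?V"
    unfolding disjnt_def
  proof (rule equals0I)
    fix z assume "z \<in> ?U \<inter> ?V"
    then obtain s c t where "s \<in> S" "c \<in> C" "t \<in> T" "a + s = c + t" by auto
    then have "a + s - t = c" by simp
    then show False using ST(4) \<open>s \<in> S\<close> \<open>t \<in> T\<close> \<open>c \<in> C\<close> by force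
  qed
  moreover have "a \<in> ?U" "C \<subseteq> ?V"
    using ST(3) by (force intro!: image_eqI[of _ _ 0])+
  ultimately show "\<exists>U V. openin euclidean U \<and> openin euclidean V \<and> a \<in> U \<and> C \<subseteq> V \<and> disjnt U V"
    using ST(1,2) by (intro exI[of _ ?U] exI[of _ ?V]) (auto intro: open_translate)
qed

text \<open>Normality is obtained from compactness and regularity, since points need not be
  separated.\<close>

lemma Urysohn_compact_group:
  fixes K U :: "'a::topological_group_add set"
  assumes comp: "compact (UNIV :: 'a set)" and K: "closed K" and U: "open U" and "K \<subseteq> U"
  obtains \<phi> :: "'a \<Rightarrow> real" where "continuous_on UNIV \<phi>" "\<And>x. 0 \<le> \<phi> x" "\<And>x. \<phi> x \<le> 1"
    "\<And>x. x \<in> K \<Longrightarrow> \<phi> x = 1" "\<And>x. x \<notin> U \<Longrightarrow> \<phi> x = 0"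
proof -
  have "compact_space (euclidean :: 'a topology)"
    using comp by (simp add: compact_space_def)
  then have "normal_space (euclidean :: 'a topology)"
    using regular_space_topological_group compact_Hausdorff_or_regular_imp_normal_space by blast
  moreover have "closedin euclidean (- U)" "closedin euclidean K" "disjnt (- U) K"
    using K U \<open>K \<subseteq> U\<close> by (auto simp: disjnt_def)
  ultimately obtain \<phi> :: "'a \<Rightarrow> real" where \<phi>: "continuous_map euclidean (top_of_set {0..1}) \<phi>"
    "\<phi> ` (- U) \<subseteq> {0}" "\<phi> ` K \<subseteq> {1}"
    using Urysohn_lemma[of euclidean "- U" K 0 1] by auto
  from \<phi>(1) have "continuous_on UNIV \<phi>" "\<phi> ` UNIV \<subseteq> {0..1}"
    by (auto simp: continuous_map_in_subtopology)
  then show thesis using \<phi>(2,3) by (intro that[of \<phi>]) (auto simp: image_subset_iff)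
qed


section \<open>Open sets between Baire sets of the same Haar measure\<close>

locale compact_haar =
  fixes \<mu> :: "'a::topological_group_add measure"
  assumes compact_UNIV: "compact (UNIV :: 'a set)"
    and haar: "haar_probability \<mu>"
begin

lemma sets_mu [measurable_cong]: "sets \<mu> = sets borel"
  using haar by (simp add: haar_probability_def)

lemma space_mu [simp]: "space \<mu> = UNIV"
  using sets_eq_imp_space_eq[OF sets_mu] by simp

sublocale prob_space \<mu>
  using haar by (simp add: haar_probability_def)

lemma emeasure_translate: "B \<in> sets borel \<Longrightarrow> emeasure \<mu> ((+) g ` B) = emeasure \<mu> B"
  using haar by (simp add: haar_probability_def)

lemma inner_regular: "B \<in> sets borel \<Longrightarrow> emeasure \<mu> B = (SUP K\<in>{K. closed K \<and> K \<subseteq> B}. emeasure \<mu> K)"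
  using haar unfolding haar_probability_def by blast

text \<open>Inner regularity exhausts \<open>U\<close> by closed sets \<open>K n\<close> up to
  measure \<open>1 / real (Suc n)\<close>. A sum of Urysohn functions of \<open>K n\<close> in
  \<open>U\<close> with geometric weights is positive on every \<open>K n\<close> and vanishes off
  \<open>U\<close>.\<close>

lemma open_inner_cozero:
  assumes U: "open U"
  obtains \<phi> :: "'a \<Rightarrow> real" where "continuous_on UNIV \<phi>" "{x. 0 < \<phi> x} \<subseteq> U" "\<And>x. 0 \<le> \<phi> x"
    "emeasure \<mu> (U - {x. 0 < \<phi> x}) = 0"
proof -
  have Ub: "U \<in> sets borel" using U by simp
  have "\<exists>K. closed K \<and> K \<subseteq> U \<and> measure \<mu> U - 1 / real (Suc n) < measure \<mu> K" for n
  \<comment> \<open>The strict comparison in \<open>ennreal\<close> needs a positive right side; if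
    \<open>U\<close> is null, the empty set serves.\<close>
  proof (cases "measure \<mu> U = 0")
    case True
    then show ?thesis by (intro exI[of _ "{}"]) auto
  next
    case False
    then have "0 < measure \<mu> U" by (simp add: zero_less_measure_iff)
    then have "ennreal (measure \<mu> U - 1 / real (Suc n)) < emeasure \<mu> U"
      unfolding emeasure_eq_measure by (intro ennreal_lessI) auto
    then obtain K where K: "closed K" "K \<subseteq> U" "ennreal (measure \<mu> U - 1 / real (Suc n)) < emeasure \<mu> K"
      unfolding inner_regular[OF Ub] less_SUP_iff by auto
    then have "measure \<mu> U - 1 / real (Suc n) < measure \<mu> K"
      by (metis emeasure_eq_measure ennreal_leI leD leI measure_nonneg)
    then show ?thesis using K by blast
  qed
  then obtain K where K: "\<And>n. closed (K n)" "\<And>n. K n \<subseteq> U" "\<And>n. measure \<mu> U - 1 / real (Suc n) < measure \<mu> (K n)"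
    by metis
  have "\<exists>\<phi>. continuous_on UNIV \<phi> \<and> (\<forall>x. 0 \<le> \<phi> x \<and> \<phi> x \<le> (1 :: real)) \<and> (\<forall>x\<in>K n. \<phi> x = 1) \<and> (\<forall>x. x \<notin> U \<longrightarrow> \<phi> x = 0)" for n
    using Urysohn_compact_group[OF compact_UNIV K(1) U K(2), of n] by metis
  then obtain \<psi> :: "nat \<Rightarrow> 'a \<Rightarrow> real" where \<psi>: "\<And>n. continuous_on UNIV (\<psi> n)" "\<And>n x. 0 \<le> \<psi> n x" "\<And>n x. \<psi> n x \<le> 1"
      "\<And>n x. x \<in> K n \<Longrightarrow> \<psi> n x = 1" "\<And>n x. x \<notin> U \<Longrightarrow> \<psi> n x = 0"
    by metis
  define \<phi> where "\<phi> x = (\<Sum>n. \<psi> n x * (1 / 2) ^ n)" for x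
  have geo: "summable (\<lambda>n. (1 / 2 :: real) ^ n)" by (simp add: summable_geometric)
  have sm: "summable (\<lambda>n. \<psi> n x * (1 / 2) ^ n)" for x
    by (rule summable_comparison_test'[OF geo]) (use \<psi>(2,3) in \<open>auto simp: abs_mult mult_le_cancel_right1\<close>)
  have lim: "uniform_limit UNIV (\<lambda>n x. \<Sum>i<n. \<psi> i x * (1 / 2) ^ i) \<phi> sequentially"
    unfolding \<phi>_def[abs_def]
    by (rule Weierstrass_m_test[OF _ geo]) (use \<psi>(2,3) in \<open>auto simp: abs_mult mult_le_cancel_right1\<close>)
  have cont: "continuous_on UNIV \<phi>"
    by (rule uniform_limit_theorem[OF _ lim]) (auto intro!: always_eventually continuous_intros \<psi>(1))
  have pos: "0 < \<phi> x \<longleftrightarrow> (\<exists>n. 0 < \<psi> n x)" for x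
    unfolding \<phi>_def using \<psi>(2) sm by (subst suminf_pos_iff) (auto simp: zero_less_mult_iff)
  have sub: "{x. 0 < \<phi> x} \<subseteq> U" using pos \<psi>(5) by (metis less_irrefl mem_Collect_eq subsetI)
  have "measure \<mu> (U - {x. 0 < \<phi> x}) \<le> 1 / real (Suc n)" for n
  proof -
    have "K n \<subseteq> {x. 0 < \<phi> x}"
      using \<psi>(4) pos by (metis mem_Collect_eq subsetI zero_less_one)
    then have "measure \<mu> (U - {x. 0 < \<phi> x}) \<le> measure \<mu> (U - K n)"
      using U K(1) by (intro finite_measure_mono) (auto simp: sets_mu)
    also have "\<dots> = measure \<mu> U - measure \<mu> (K n)"
      using U K(1,2) by (intro finite_measure_Diff) (auto simp: sets_mu)
    finally show ?thesis using K(3)[of n] by linarith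
  qed
  then have "measure \<mu> (U - {x. 0 < \<phi> x}) \<le> 0"
    using reals_Archimedean by (metis inverse_eq_divide leD leI)
  then have "emeasure \<mu> (U - {x. 0 < \<phi> x}) = 0"
    using measure_nonneg[of \<mu> "U - {x. 0 < \<phi> x}"] by (simp add: emeasure_eq_measure)
  moreover have "0 \<le> \<phi> x" for x
    unfolding \<phi>_def using \<psi>(2) sm by (intro suminf_nonneg) auto
  ultimately show thesis using cont sub by (intro that)
qed

text \<open>
  The elements \<open>n\<close> with \<open>\<phi> (n + z) = \<phi> z\<close> for all \<open>z\<close> form a subgroup, and the outer set is the union of
  the translates \<open>n + U\<close>. A compact subset of its difference with \<open>{x. 0 < \<phi> x}\<close> is covered by finitely
  many of the null sets \<open>n + (U - {x. 0 < \<phi> x})\<close>.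
\<close>

lemma open_outer_baire:
  assumes U: "open U" and \<phi>: "continuous_on UNIV \<phi>" "{x. 0 < \<phi> x} \<subseteq> U" "\<And>x. (0 :: real) \<le> \<phi> x"
    and null: "emeasure \<mu> (U - {x. 0 < \<phi> x}) = 0"
  obtains S where "S \<in> sets baire_algebra" "U \<subseteq> S" "emeasure \<mu> (S - {x. 0 < \<phi> x}) = 0"
proof -
  let ?\<Phi> = "translate_fun \<phi>"
  define S where "S = {y. \<exists>u\<in>U. ?\<Phi> y = ?\<Phi> u}"
  define N where "N = {n. \<forall>z. \<phi> (n + z) = \<phi> z}"
  note eq_iff = translate_fun_eq_iff[OF compact_UNIV \<phi>(1)]
  have S_eq: "S = (\<Union>n\<in>N. (+) n ` U)"
  proof (intro equalityI subsetI)
    fix y assume "y \<in> S"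
    then obtain u where u: "u \<in> U" "\<And>z. \<phi> (y + z) = \<phi> (u + z)" by (auto simp: S_def eq_iff)
    have "\<phi> (y - u + z) = \<phi> z" for z
      using u(2)[of "- u + z"] by (simp add: add.assoc[symmetric])
    then have "y - u \<in> N" by (simp add: N_def)
    moreover have "y = (y - u) + u" by simp
    ultimately show "y \<in> (\<Union>n\<in>N. (+) n ` U)" using u(1) by blast
  next
    fix y assume "y \<in> (\<Union>n\<in>N. (+) n ` U)"
    then show "y \<in> S" by (auto simp: S_def N_def eq_iff add.assoc)
  qed
  have oS: "open S" unfolding S_eq using U by (auto intro: open_translate)
  have US: "U \<subseteq> S" by (auto simp: S_def)
  have cont: "continuous_on UNIV ?\<Phi>" by (rule continuous_translate_fun[OF compact_UNIV \<phi>(1)])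
  \<comment> \<open>\<open>S\<close> is saturated for \<open>?\<Phi>\<close>, so the image of
    \<open>- S\<close> misses the image of \<open>S\<close>. Being compact in a metric space it is
    closed, and the distance to it exhibits \<open>S\<close> as a cozero set.\<close>
  have "compact (- S)"
    using compact_Int_closed[OF compact_UNIV, of "- S"] closed_Compl[OF oS] by simp
  then have "compact (?\<Phi> ` (- S))"
    by (intro compact_continuous_image continuous_on_subset[OF cont]) auto
  then have cl: "closed (?\<Phi> ` (- S))" by (rule compact_imp_closed)
  have "S \<in> sets baire_algebra"
  \<comment> \<open>The distance to the empty set is \<open>0\<close> by convention, so this case is
    separate.\<close>
  proof (cases "- S = {}")
    case True
    then have "S = space baire_algebra" by auto
    then show ?thesis by (metis sets.top)
  next
    case False
    have "?\<Phi> y \<notin> ?\<Phi> ` (- S)" if "y \<in> S" for y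
      using that by (auto simp: S_def)
    moreover have "?\<Phi> ` (- S) \<noteq> {}" using False by blast
    ultimately have "0 < infdist (?\<Phi> y) (?\<Phi> ` (- S))" if "y \<in> S" for y
      using infdist_pos_not_in_closed[OF cl] that by blast
    moreover have "infdist (?\<Phi> y) (?\<Phi> ` (- S)) = 0" if "y \<notin> S" for y
      using that by (intro infdist_zero) blast
    ultimately have "S = {y. 0 < infdist (?\<Phi> y) (?\<Phi> ` (- S))}"
      by (metis (lifting) Collect_mem_eq Collect_cong less_irrefl)
    moreover have "continuous_on UNIV (\<lambda>y. infdist (?\<Phi> y) (?\<Phi> ` (- S)))"
      by (intro continuous_on_infdist cont)
    then have "{y. 0 < infdist (?\<Phi> y) (?\<Phi> ` (- S))} \<in> sets baire_algebra"
      by (rule cozero_in_baire_algebra)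
    ultimately show ?thesis by argo
  qed
  moreover have "emeasure \<mu> (S - {x. 0 < \<phi> x}) = 0"
  proof -
    let ?D = "U - {x. 0 < \<phi> x}"
    have oV: "open {x. 0 < \<phi> x}" by (intro open_Collect_less continuous_on_const \<phi>(1))
    have Db: "?D \<in> sets borel" using U oV by auto
    have "emeasure \<mu> K = 0" if K: "closed K" "K \<subseteq> S - {x. 0 < \<phi> x}" for K
    proof -
      have "compact K" using compact_Int_closed[OF compact_UNIV K(1)] by simp
      moreover have "K \<subseteq> (\<Union>n\<in>N. (+) n ` U)" using K(2) S_eq by auto
      ultimately obtain N' where N': "N' \<subseteq> N" "finite N'" "K \<subseteq> (\<Union>n\<in>N'. (+) n ` U)"
        using compactE_image[of K N "\<lambda>n. (+) n ` U"] U by (metis open_translate)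
      have "K \<subseteq> (\<Union>n\<in>N'. (+) n ` ?D)"
      proof
        fix x assume x: "x \<in> K"
        then obtain n u where n: "n \<in> N'" "u \<in> U" "x = n + u" using N'(3) by auto
        \<comment> \<open>As \<open>n\<close> stabilises \<open>\<phi>\<close>, the zero of
          \<open>\<phi>\<close> at \<open>x\<close> gives one at \<open>u\<close>.\<close>
        have "\<phi> u = \<phi> x" using n N'(1) by (auto simp: N_def)
        then have "u \<in> ?D" using n(2) x K(2) by auto
        then show "x \<in> (\<Union>n\<in>N'. (+) n ` ?D)" using n by blast
      qed
      moreover have "(+) n ` ?D \<in> null_sets \<mu>" for n
      proof -
        have "(+) n ` ?D = (+) n ` U - (+) n ` {x. 0 < \<phi> x}" by (rule image_set_diff) simp
        then have "(+) n ` ?D \<in> sets borel" using open_translate[OF U, of n] open_translate[OF oV, of n] by simp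
        then show ?thesis using emeasure_translate[OF Db] null by (simp add: null_sets_def sets_mu)
      qed
      then have "(\<Union>n\<in>N'. (+) n ` ?D) \<in> null_sets \<mu>"
        using N'(2) by (intro null_sets.finite_UN) auto
      ultimately show ?thesis
        using K(1) by (metis borel_closed null_setsD1 null_sets_subset sets_mu)
    qed
    then have "(SUP K\<in>{K. closed K \<and> K \<subseteq> S - {x. 0 < \<phi> x}}. emeasure \<mu> K) \<le> 0"
      by (intro SUP_least) auto
    then show ?thesis
      using oS oV inner_regular[of "S - {x. 0 < \<phi> x}"] by simp
  qed
  ultimately show thesis using US by (intro that)
qed

section \<open>The Baire restriction of Haar measure and Baire versions of Borel functions\<close>

abbreviation M :: "'a measure" where "M \<equiv> baire_measure \<mu>"

lemma subalgebra_baire: "Conditional_Expectation.subalgebra \<mu> baire_algebra"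
  using baire_algebra_subset_borel by (auto simp: Conditional_Expectation.subalgebra_def sets_mu)

lemma sets_M: "sets M = sets baire_algebra"
  unfolding baire_measure_def by (rule sets_restr_to_subalg[OF subalgebra_baire])

lemma emeasure_M: "A \<in> sets baire_algebra \<Longrightarrow> emeasure M A = emeasure \<mu> A"
  unfolding baire_measure_def by (rule emeasure_restr_to_subalg[OF subalgebra_baire])

lemma sets_M_borel: "A \<in> sets M \<Longrightarrow> A \<in> sets borel"
  using baire_algebra_subset_borel by (auto simp: sets_M)

sublocale baire: invariant_probability M
proof -
  interpret M: prob_space M
    unfolding baire_measure_def
    by (rule prob_space_restr_to_subalg[OF subalgebra_baire prob_space_axioms])
  have cong: "sets (M \<Otimes>\<^sub>M M) = sets (baire_algebra \<Otimes>\<^sub>M baire_algebra)"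
    by (intro sets_pair_measure_cong sets_M)
  have plus: "(\<lambda>p. fst p + snd p) \<in> M \<Otimes>\<^sub>M M \<rightarrow>\<^sub>M M"
    using measurable_plus_baire[OF compact_UNIV] measurable_cong_sets[OF cong sets_M] by blast
  have minus: "uminus \<in> M \<rightarrow>\<^sub>M M"
    using measurable_uminus_baire measurable_cong_sets[OF sets_M sets_M] by blast
  have space: "space M = UNIV"
    using sets_eq_imp_space_eq[OF sets_M] by simp
  have left: "distr M M ((+) g) = M" for g
  proof (rule measure_eqI)
    have "(\<lambda>x. fst (g, x) + snd (g, x)) \<in> M \<rightarrow>\<^sub>M M"
      by (rule measurable_compose[OF measurable_Pair1' plus]) (simp add: space)
    then have m: "(+) g \<in> M \<rightarrow>\<^sub>M M" by simp
    fix A assume "A \<in> sets (distr M M ((+) g))"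
    then have A: "A \<in> sets M" by simp
    have "(+) g -` A = (+) (- g) ` A"
      by (force simp: image_iff intro: bexI[of _ "g + _"])
    moreover have "(+) g -` A \<in> sets M"
      using measurable_sets[OF m A] by (simp add: space)
    ultimately show "emeasure (distr M M ((+) g)) A = emeasure M A"
      using A emeasure_distr[OF m A] emeasure_translate[of A "- g"] sets_M_borel[OF A]
      by (simp add: space emeasure_M sets_M)
  qed simp
  show "invariant_probability M"
    by unfold_locales (fact space plus minus left)+
qed

lemma sets_borel_subset_completion: "sets borel \<subseteq> sets (completion M)"
proof -
  have "U \<in> sets (completion M)" if U: "open U" for U
  proof -
    obtain \<phi> :: "'a \<Rightarrow> real" where \<phi>: "continuous_on UNIV \<phi>" "{x. 0 < \<phi> x} \<subseteq> U" "\<And>x. 0 \<le> \<phi> x"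
      and null: "emeasure \<mu> (U - {x. 0 < \<phi> x}) = 0"
      using open_inner_cozero[OF U] by blast
    obtain S where S: "S \<in> sets baire_algebra" "U \<subseteq> S" "emeasure \<mu> (S - {x. 0 < \<phi> x}) = 0"
      by (rule open_outer_baire[OF U \<phi> null])
    have V: "{x. 0 < \<phi> x} \<in> sets M"
      using cozero_in_baire_algebra[OF \<phi>(1)] by (simp add: sets_M)
    then have "S - {x. 0 < \<phi> x} \<in> null_sets M"
      using S(1,3) by (auto simp: null_sets_def emeasure_M sets_M)
    moreover have "U = {x. 0 < \<phi> x} \<union> (U - {x. 0 < \<phi> x})" using \<phi>(2) by auto
    moreover have "U - {x. 0 < \<phi> x} \<subseteq> S - {x. 0 < \<phi> x}" using S(2) by auto
    ultimately show ?thesis using V by (metis sets_completionI)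
  qed
  then have "sigma_sets (space (completion M)) {U. open U} \<subseteq> sets (completion M)"
    by (intro sets.sigma_sets_subset) auto
  then show ?thesis by (simp add: borel_def sets_measure_of_conv)
qed

lemma bounded_borel_baire_version:
  assumes f: "f \<in> bounded_borel"
  obtains f' where "f' \<in> baire.bounded_measurable" "AE x in M. f x = f' x"
proof -
  have f_m: "f \<in> borel_measurable (completion M)"
    using f sets_borel_subset_completion unfolding bounded_borel_def measurable_def by auto
  then have "(\<lambda>x. Re (f x)) \<in> borel_measurable (completion M)" "(\<lambda>x. Im (f x)) \<in> borel_measurable (completion M)"
    by measurable
  then obtain r i where ri [measurable]: "r \<in> borel_measurable M" "i \<in> borel_measurable M"
    and ae: "AE x in M. Re (f x) = r x" "AE x in M. Im (f x) = i x"
    using completion_ex_borel_measurable_real by metis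
  obtain C where C: "\<And>x. cmod (f x) \<le> C"
    using f by (auto simp: bounded_borel_def bounded_iff)
  define g where "g x = of_real (r x) + \<i> * of_real (i x)" for x
  \<comment> \<open>\<open>g\<close> may exceed the bound of \<open>f\<close> on a null set; cutting
    it off there restores boundedness everywhere.\<close>
  define f' where "f' x = (if cmod (g x) \<le> C then g x else 0)" for x
  have [measurable]: "g \<in> borel_measurable M"
    unfolding g_def[abs_def] by measurable
  have "f' \<in> borel_measurable M"
    unfolding f'_def[abs_def] by measurable
  moreover have "cmod (f' x) \<le> C" for x
    using order_trans[OF norm_ge_zero C] by (auto simp: f'_def)
  then have "bounded (range f')" by (auto simp: bounded_iff)
  moreover have "AE x in M. f x = f' x"
    using ae
  proof eventually_elim
    case (elim x)
    then have "f x = g x" by (simp add: g_def complex_eq_iff)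
    then show ?case using C[of x] by (simp add: f'_def)
  qed
  ultimately show thesis
    by (intro that) (auto simp: baire.bounded_measurable_def)
qed

lemma AE_M_imp_AE_mu: "AE x in M. Q x \<Longrightarrow> AE x in \<mu>. Q x"
  unfolding baire_measure_def by (rule AE_restr_to_subalg[OF subalgebra_baire])

text \<open>The set where two Baire functions differ is a Baire set, and on those the two measures
  agree.\<close>

lemma AE_mu_imp_AE_M:
  assumes ae: "AE x in \<mu>. f x = g x" and m: "f \<in> baire.bounded_measurable" "g \<in> baire.bounded_measurable"
  shows "AE x in M. f x = g x"
proof -
  have "f \<in> borel_measurable baire_algebra" "g \<in> borel_measurable baire_algebra"
    using m measurable_cong_sets[OF sets_M refl] by (auto dest: baire.bounded_measurableD)
  then have "Measurable.pred baire_algebra (\<lambda>x. f x = g x)" by measurable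
  then show ?thesis
    unfolding baire_measure_def by (rule AE_restr_to_subalg2[OF subalgebra_baire ae])
qed

text \<open>The products of \<open>\<mu>\<close> and of \<open>M\<close> live on different
  sigma-algebras; transport along the identity carries integrals of Baire functions from one to the
  other.\<close>

lemma distr_PiM_baire:
  "distr (\<Pi>\<^sub>M i\<in>{0..n}. \<mu>) (baire.P n) (\<lambda>a. a) = baire.P n"
proof -
  let ?Q = "\<Pi>\<^sub>M i\<in>{0..n}. \<mu>"
  have id: "(\<lambda>x. x) \<in> \<mu> \<rightarrow>\<^sub>M M"
    by (rule measurableI) (auto simp: sets_mu sets_M_borel)
  have distr: "distr \<mu> M (\<lambda>x. x) = M"
  proof (rule measure_eqI)
    fix A assume "A \<in> sets (distr \<mu> M (\<lambda>x. x))"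
    then have A: "A \<in> sets M" by simp
    then show "emeasure (distr \<mu> M (\<lambda>x. x)) A = emeasure M A"
      using emeasure_distr[OF id A] emeasure_M[of A] by (simp add: sets_M)
  qed simp
  have "distr ?Q (baire.P n) (compose {0..n} (\<lambda>x. x)) = (\<Pi>\<^sub>M i\<in>{0..n}. distr \<mu> M (\<lambda>x. x))"
    by (rule distr_PiM_finite_prob_space'[of "{0..n}" "\<lambda>i. \<mu>" "\<lambda>i. M"])
       (use id prob_space_axioms baire.prob_space_axioms in auto)
  \<comment> \<open>Points of the product space are extensional, so \<open>compose\<close> with the
    identity leaves them unchanged.\<close>
  moreover have "distr ?Q (baire.P n) (compose {0..n} (\<lambda>x. x)) = distr ?Q (baire.P n) (\<lambda>a. a)"
    by (rule distr_cong) (auto simp: space_PiM compose_def PiE_iff extensional_restrict restrict_def extensional_def fun_eq_iff)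
  ultimately show ?thesis by (simp add: distr)
qed

lemma measurable_id_PiM_baire: "(\<lambda>a. a) \<in> (\<Pi>\<^sub>M i\<in>{0..n}. \<mu>) \<rightarrow>\<^sub>M baire.P n"
proof -
  have id: "(\<lambda>x. x) \<in> \<mu> \<rightarrow>\<^sub>M M"
    by (rule measurableI) (auto simp: sets_mu sets_M_borel)
  have "(\<lambda>a. \<lambda>i\<in>{0..n}. a i) \<in> (\<Pi>\<^sub>M i\<in>{0..n}. \<mu>) \<rightarrow>\<^sub>M baire.P n"
    by (intro measurable_restrict measurable_compose[OF _ id] measurable_component_singleton)
  moreover have "(\<lambda>i\<in>{0..n}. a i) = a" if "a \<in> space (\<Pi>\<^sub>M i\<in>{0..n}. \<mu>)" for a
    using that by (auto simp: space_PiM PiE_iff intro: extensional_restrict)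
  ultimately show ?thesis by (subst measurable_cong[where g = "\<lambda>a. \<lambda>i\<in>{0..n}. a i"]) auto
qed

text \<open>\<open>f\<close> and \<open>f'\<close> agree at all vertices of almost every cube. The
  integrand of \<open>f\<close> is measurable for the completed product because it equals that of
  \<open>f'\<close> almost everywhere.\<close>

lemma gowers_baire_version:
  assumes f: "f \<in> bounded_borel" and f': "f' \<in> baire.bounded_measurable" and ae: "AE x in M. f x = f' x"
    and n: "1 \<le> n"
  shows "integrable (haar_power \<mu> n) (gowers_integrand n f)"
    and "gowers_integral \<mu> n f = baire.gowers_form n (\<lambda>v. f')"
    and "gowers_norm \<mu> n f = baire.unorm n f'"
proof -
  let ?Q = "\<Pi>\<^sub>M i\<in>{0..n}. \<mu>"
  let ?g = "gowers_kernel n (\<lambda>v. f')"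
  have int: "gowers_integrand n f = gowers_kernel n (\<lambda>v. f)"
    by (intro ext) (simp add: gowers_integrand_def gowers_kernel_def cube_def)
  have "AE a in baire.P n. \<forall>v\<in>cube n. f (cube_point n a v) = f' (cube_point n a v)"
    using baire.AE_cube_point[OF ae n] by (intro AE_finite_allI) auto
  then have "AE a in baire.P n. gowers_kernel n (\<lambda>v. f) a = ?g a"
    by eventually_elim (simp add: gowers_kernel_def)
  then have "AE a in distr ?Q (baire.P n) (\<lambda>a. a). gowers_kernel n (\<lambda>v. f) a = ?g a"
    unfolding distr_PiM_baire .
  then have "AE a in ?Q. gowers_kernel n (\<lambda>v. f) a = ?g a"
    by (rule AE_distrD[OF measurable_id_PiM_baire])
  then have ae_g: "AE a in haar_power \<mu> n. gowers_kernel n (\<lambda>v. f) a = ?g a"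
    unfolding haar_power_def by (rule AE_completion)
  have g_P: "?g \<in> borel_measurable (baire.P n)"
    using f' by (intro baire.measurable_gowers_kernel baire.bounded_measurableD)
  then have g_Q: "?g \<in> borel_measurable ?Q"
    by (rule measurable_compose[OF measurable_id_PiM_baire])
  then have g_m: "?g \<in> borel_measurable (haar_power \<mu> n)"
    unfolding haar_power_def by (rule measurable_completion)
  have f_m: "gowers_kernel n (\<lambda>v. f) \<in> borel_measurable (haar_power \<mu> n)"
  proof (rule measurableI)
    fix B :: "complex set" assume B: "B \<in> sets borel"
    show "gowers_kernel n (\<lambda>v. f) -` B \<inter> space (haar_power \<mu> n) \<in> sets (haar_power \<mu> n)"
      unfolding haar_power_def
    proof (rule completion.in_sets_AE)
      show "?g -` B \<inter> space (completion ?Q) \<in> sets (completion ?Q)"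
        using measurable_sets[OF g_m B] by (simp add: haar_power_def)
      show "AE a in completion ?Q. (a \<in> ?g -` B \<inter> space (completion ?Q)) =
          (a \<in> gowers_kernel n (\<lambda>v. f) -` B \<inter> space (completion ?Q))"
        using ae_g[unfolded haar_power_def] by eventually_elim auto
    qed auto
  qed auto
  have "integrable (distr ?Q (baire.P n) (\<lambda>a. a)) ?g"
    unfolding distr_PiM_baire by (rule baire.integrable_gowers_kernel) (rule f')
  then have "integrable ?Q ?g"
    by (simp add: integrable_distr_eq[OF measurable_id_PiM_baire g_P])
  then have "integrable (haar_power \<mu> n) ?g"
    unfolding haar_power_def using integrable_completion[OF g_Q] by simp
  then show "integrable (haar_power \<mu> n) (gowers_integrand n f)"
    unfolding int using integrable_cong_AE[OF f_m g_m ae_g] by simp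
  have "gowers_integral \<mu> n f = (\<integral>a. ?g a \<partial>haar_power \<mu> n)"
    unfolding gowers_integral_def int by (rule integral_cong_AE[OF f_m g_m ae_g])
  also have "\<dots> = (\<integral>a. ?g a \<partial>?Q)"
    unfolding haar_power_def by (rule integral_completion[OF g_Q])
  also have "\<dots> = (\<integral>a. ?g a \<partial>distr ?Q (baire.P n) (\<lambda>a. a))"
    by (rule integral_distr[OF measurable_id_PiM_baire g_P, symmetric])
  finally show form: "gowers_integral \<mu> n f = baire.gowers_form n (\<lambda>v. f')"
    unfolding distr_PiM_baire baire.gowers_form_def .
  show "gowers_norm \<mu> n f = baire.unorm n f'"
    unfolding gowers_norm_def form baire.unorm_def
    by (subst baire.gowers_form_nonneg[OF f' n]) simp
qed

section \<open>Transfer of the seminorm properties to bounded Borel functions\<close>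

lemma gowers_norm_cong_AE:
  assumes "f \<in> bounded_borel" "g \<in> bounded_borel" "AE x in \<mu>. f x = g x" and n: "1 \<le> n"
  shows "gowers_norm \<mu> n f = gowers_norm \<mu> n g"
proof -
  obtain f' where f': "f' \<in> baire.bounded_measurable" "AE x in M. f x = f' x"
    by (rule bounded_borel_baire_version[OF assms(1)])
  obtain g' where g': "g' \<in> baire.bounded_measurable" "AE x in M. g x = g' x"
    by (rule bounded_borel_baire_version[OF assms(2)])
  have "AE x in \<mu>. f' x = g' x"
    using AE_M_imp_AE_mu[OF f'(2)] AE_M_imp_AE_mu[OF g'(2)] assms(3) by eventually_elim simp
  then have "AE x in M. f' x = g' x"
    by (rule AE_mu_imp_AE_M[OF _ f'(1) g'(1)])
  then show ?thesis
    using gowers_baire_version(3)[OF assms(1) f' n] gowers_baire_version(3)[OF assms(2) g' n]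
      baire.unorm_cong_AE[OF f'(1) g'(1) _ n] by simp
qed

lemma bounded_borel_add:
  assumes "f \<in> bounded_borel" "g \<in> bounded_borel"
  shows "(\<lambda>x. f x + g x :: complex) \<in> bounded_borel"
proof -
  have "bounded (range (\<lambda>x. f x + g x))"
    using assms by (auto simp: bounded_borel_def intro!: bounded_plus_comp)
  then show ?thesis using assms by (auto simp: bounded_borel_def)
qed

lemma bounded_borel_cmult:
  assumes "f \<in> bounded_borel"
  shows "(\<lambda>x. c * f x) \<in> bounded_borel"
proof -
  obtain C where "\<And>x. cmod (f x) \<le> C"
    using assms by (auto simp: bounded_borel_def bounded_iff)
  then have "cmod (c * f x) \<le> cmod c * C" for x
    by (simp add: norm_mult mult_left_mono)
  then show ?thesis using assms by (auto simp: bounded_borel_def bounded_iff)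
qed

lemma bounded_borel_const: "(\<lambda>x. c) \<in> bounded_borel"
  by (auto simp: bounded_borel_def)

lemma gowers_norm_triangle:
  assumes "f \<in> bounded_borel" "g \<in> bounded_borel" and n: "1 \<le> n"
  shows "gowers_norm \<mu> n (\<lambda>x. f x + g x) \<le> gowers_norm \<mu> n f + gowers_norm \<mu> n g"
proof -
  obtain f' where f': "f' \<in> baire.bounded_measurable" "AE x in M. f x = f' x"
    by (rule bounded_borel_baire_version[OF assms(1)])
  obtain g' where g': "g' \<in> baire.bounded_measurable" "AE x in M. g x = g' x"
    by (rule bounded_borel_baire_version[OF assms(2)])
  have ae: "AE x in M. f x + g x = f' x + g' x"
    using f'(2) g'(2) by eventually_elim simp
  show ?thesis
    using gowers_baire_version(3)[OF assms(1) f' n] gowers_baire_version(3)[OF assms(2) g' n]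
      gowers_baire_version(3)[OF bounded_borel_add[OF assms(1,2)] baire.bounded_measurable_add[OF f'(1) g'(1)] ae n]
      baire.unorm_triangle[OF f'(1) g'(1) n] by simp
qed

lemma gowers_norm_cmult:
  assumes "f \<in> bounded_borel" and n: "1 \<le> n"
  shows "gowers_norm \<mu> n (\<lambda>x. c * f x) = cmod c * gowers_norm \<mu> n f"
proof -
  obtain f' where f': "f' \<in> baire.bounded_measurable" "AE x in M. f x = f' x"
    by (rule bounded_borel_baire_version[OF assms(1)])
  have ae: "AE x in M. c * f x = c * f' x"
    using f'(2) by eventually_elim simp
  obtain C where C: "\<And>x. cmod (f' x) \<le> C"
    using baire.bounded_measurable_bound[OF f'(1)] by metis
  have "cmod (c * f' x) \<le> cmod c * C" for x
    using C by (simp add: norm_mult mult_left_mono)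
  then have cf': "(\<lambda>x. c * f' x) \<in> baire.bounded_measurable"
    using f'(1) by (auto simp: baire.bounded_measurable_def bounded_iff)
  show ?thesis
    using gowers_baire_version(3)[OF assms(1) f' n]
      gowers_baire_version(3)[OF bounded_borel_cmult[OF assms(1)] cf' ae n]
      baire.unorm_cmult[OF n, of c f'] by simp
qed

lemma gowers_norm_nonneg:
  assumes "f \<in> bounded_borel" and n: "1 \<le> n"
  shows "0 \<le> gowers_norm \<mu> n f"
proof -
  obtain f' where f': "f' \<in> baire.bounded_measurable" "AE x in M. f x = f' x"
    by (rule bounded_borel_baire_version[OF assms(1)])
  show ?thesis
    using gowers_baire_version(3)[OF assms(1) f' n] baire.unorm_nonneg by simp
qed

lemma gowers_norm_eq_0_iff:
  assumes "f \<in> bounded_borel" and n: "2 \<le> n"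
  shows "gowers_norm \<mu> n f = 0 \<longleftrightarrow> (AE x in \<mu>. f x = 0)"
proof
  have n1: "1 \<le> n" using n by simp
  assume norm: "gowers_norm \<mu> n f = 0"
  obtain f' where f': "f' \<in> baire.bounded_measurable" "AE x in M. f x = f' x"
    by (rule bounded_borel_baire_version[OF assms(1)])
  have "baire.unorm n f' = 0"
    using gowers_baire_version(3)[OF assms(1) f' n1] norm by simp
  then have "AE x in M. f' x = 0"
    by (rule baire.unorm_eq_0_imp_AE[OF f'(1) n])
  then have "AE x in M. f x = 0" using f'(2) by eventually_elim simp
  then show "AE x in \<mu>. f x = 0" by (rule AE_M_imp_AE_mu)
next
  have n1: "1 \<le> n" using n by simp
  assume "AE x in \<mu>. f x = 0"
  \<comment> \<open>Homogeneity with the scalar \<open>0\<close> settles this direction.\<close>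
  then have "AE x in \<mu>. f x = (\<lambda>x. 0 * f x) x" by eventually_elim simp
  then have "gowers_norm \<mu> n f = gowers_norm \<mu> n (\<lambda>x. 0 * f x)"
    by (intro gowers_norm_cong_AE assms(1) bounded_borel_cmult n1)
  also have "\<dots> = 0" unfolding gowers_norm_cmult[OF assms(1) n1] by simp
  finally show "gowers_norm \<mu> n f = 0" .
qed

lemma gowers_integral_nonneg:
  assumes f: "f \<in> bounded_borel" and n: "1 \<le> n"
  shows "integrable (haar_power \<mu> n) (gowers_integrand n f)"
    and "gowers_integral \<mu> n f \<in> \<real>" and "0 \<le> Re (gowers_integral \<mu> n f)"
proof -
  obtain f' where f': "f' \<in> baire.bounded_measurable" "AE x in M. f x = f' x"
    by (rule bounded_borel_baire_version[OF f])
  show "integrable (haar_power \<mu> n) (gowers_integrand n f)"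
    by (rule gowers_baire_version(1)[OF f f' n])
  have "gowers_integral \<mu> n f = of_real (cmod (baire.gowers_form n (\<lambda>v. f')))"
    using gowers_baire_version(2)[OF f f' n] baire.gowers_form_nonneg[OF f'(1) n] by simp
  then show "gowers_integral \<mu> n f \<in> \<real>" "0 \<le> Re (gowers_integral \<mu> n f)" by simp_all
qed

end

section \<open>The normed space\<close>

context compact_haar
begin

abbreviation cls :: "('a \<Rightarrow> complex) \<Rightarrow> ('a \<Rightarrow> complex) set" where
  "cls f \<equiv> ae_rel \<mu> `` {f}"

lemma equiv_ae_rel: "equiv bounded_borel (ae_rel \<mu>)"
proof (rule equivI)
  show "ae_rel \<mu> \<subseteq> bounded_borel \<times> bounded_borel" "refl_on bounded_borel (ae_rel \<mu>)" "sym (ae_rel \<mu>)"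
    by (auto simp: ae_rel_def refl_on_def sym_def eq_commute)
  show "trans (ae_rel \<mu>)"
  proof (rule transI)
    fix f g h assume fg: "(f, g) \<in> ae_rel \<mu>" and gh: "(g, h) \<in> ae_rel \<mu>"
    then have "AE x in \<mu>. f x = g x" "AE x in \<mu>. g x = h x" by (auto simp: ae_rel_def)
    then have "AE x in \<mu>. f x = h x" by eventually_elim simp
    then show "(f, h) \<in> ae_rel \<mu>" using fg gh by (auto simp: ae_rel_def)
  qed
qed

lemma cls_eqI:
  assumes "f \<in> bounded_borel" "g \<in> bounded_borel" "AE x in \<mu>. f x = g x"
  shows "cls f = cls g"
  using assms by (intro equiv_class_eq[OF equiv_ae_rel]) (simp add: ae_rel_def)

lemma cls_eq_iff:
  assumes "f \<in> bounded_borel" "g \<in> bounded_borel"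
  shows "cls f = cls g \<longleftrightarrow> (AE x in \<mu>. f x = g x)"
  using eq_equiv_class_iff[OF equiv_ae_rel assms] assms by (simp add: ae_rel_def)

lemma carrier_LinfI: "f \<in> bounded_borel \<Longrightarrow> cls f \<in> carrier (Linf \<mu>)"
  by (auto simp: Linf_def intro: quotientI)

lemma carrier_LinfE:
  assumes "A \<in> carrier (Linf \<mu>)"
  obtains f where "f \<in> bounded_borel" "A = cls f"
  using assms by (auto simp: Linf_def elim: quotientE)

lemma Linf_zero: "\<zero>\<^bsub>Linf \<mu>\<^esub> = cls (\<lambda>x. 0)"
  by (simp add: Linf_def)

text \<open>The operation on classes is a union over all representatives; congruence makes it a
  union of equal classes.\<close>

lemma Linf_add:
  assumes "f \<in> bounded_borel" "g \<in> bounded_borel"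
  shows "cls f \<oplus>\<^bsub>Linf \<mu>\<^esub> cls g = cls (\<lambda>x. f x + g x)"
proof -
  have "congruent2 (ae_rel \<mu>) (ae_rel \<mu>) (\<lambda>f g. cls (\<lambda>x. f x + g x))"
  proof (rule congruent2I')
    fix f f' g g' assume r: "(f, f') \<in> ae_rel \<mu>" "(g, g') \<in> ae_rel \<mu>"
    then have "AE x in \<mu>. f x = f' x" "AE x in \<mu>. g x = g' x" by (auto simp: ae_rel_def)
    then have "AE x in \<mu>. f x + g x = f' x + g' x" by eventually_elim simp
    then show "cls (\<lambda>x. f x + g x) = cls (\<lambda>x. f' x + g' x)"
      using r by (intro cls_eqI bounded_borel_add) (auto simp: ae_rel_def)
  qed
  from UN_equiv_class2[OF equiv_ae_rel equiv_ae_rel this assms] show ?thesis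
    by (simp add: Linf_def)
qed

lemma Linf_smult:
  assumes "f \<in> bounded_borel"
  shows "c \<odot>\<^bsub>Linf \<mu>\<^esub> cls f = cls (\<lambda>x. c * f x)"
proof -
  have "congruent (ae_rel \<mu>) (\<lambda>f. cls (\<lambda>x. c * f x))"
  proof (rule congruentI)
    fix f f' assume r: "(f, f') \<in> ae_rel \<mu>"
    then have "AE x in \<mu>. f x = f' x" by (auto simp: ae_rel_def)
    then have "AE x in \<mu>. c * f x = c * f' x" by eventually_elim simp
    then show "cls (\<lambda>x. c * f x) = cls (\<lambda>x. c * f' x)"
      using r by (intro cls_eqI bounded_borel_cmult) (auto simp: ae_rel_def)
  qed
  from UN_equiv_class[OF equiv_ae_rel this assms] show ?thesis
    by (simp add: Linf_def)
qed

lemma Linf_gowers_norm_cls: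
  assumes f: "f \<in> bounded_borel" and n: "1 \<le> n"
  shows "Linf_gowers_norm \<mu> n (cls f) = gowers_norm \<mu> n f"
proof -
  have "f \<in> cls f" using f by (simp add: ae_rel_def)
  then have "(SOME g. g \<in> cls f) \<in> cls f" using someI[of "\<lambda>g. g \<in> cls f" f] by blast
  then have "(SOME g. g \<in> cls f) \<in> bounded_borel" "AE x in \<mu>. f x = (SOME g. g \<in> cls f) x"
    by (auto simp: ae_rel_def)
  then show ?thesis
    unfolding Linf_gowers_norm_def using gowers_norm_cong_AE[OF f _ _ n] by metis
qed

lemma abelian_group_Linf: "abelian_group (Linf \<mu>)"
proof (rule abelian_groupI)
  show "\<zero>\<^bsub>Linf \<mu>\<^esub> \<in> carrier (Linf \<mu>)"
    unfolding Linf_zero by (intro carrier_LinfI bounded_borel_const)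
next
  fix A B assume "A \<in> carrier (Linf \<mu>)" "B \<in> carrier (Linf \<mu>)"
  then obtain f g where f: "f \<in> bounded_borel" "A = cls f" and g: "g \<in> bounded_borel" "B = cls g"
    by (metis carrier_LinfE)
  show "A \<oplus>\<^bsub>Linf \<mu>\<^esub> B \<in> carrier (Linf \<mu>)"
    using f g by (auto simp: Linf_add intro!: carrier_LinfI bounded_borel_add)
  show "A \<oplus>\<^bsub>Linf \<mu>\<^esub> B = B \<oplus>\<^bsub>Linf \<mu>\<^esub> A"
    using f g by (simp add: Linf_add add.commute)
next
  fix A B C assume "A \<in> carrier (Linf \<mu>)" "B \<in> carrier (Linf \<mu>)" "C \<in> carrier (Linf \<mu>)"
  then obtain f g h where f: "f \<in> bounded_borel" "A = cls f" and g: "g \<in> bounded_borel" "B = cls g"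
    and h: "h \<in> bounded_borel" "C = cls h"
    by (metis carrier_LinfE)
  then show "A \<oplus>\<^bsub>Linf \<mu>\<^esub> B \<oplus>\<^bsub>Linf \<mu>\<^esub> C = A \<oplus>\<^bsub>Linf \<mu>\<^esub> (B \<oplus>\<^bsub>Linf \<mu>\<^esub> C)"
    by (simp add: Linf_add bounded_borel_add add.assoc)
next
  fix A assume "A \<in> carrier (Linf \<mu>)"
  then obtain f where f: "f \<in> bounded_borel" "A = cls f" by (rule carrier_LinfE)
  show "\<zero>\<^bsub>Linf \<mu>\<^esub> \<oplus>\<^bsub>Linf \<mu>\<^esub> A = A"
    using f by (simp add: Linf_zero Linf_add bounded_borel_const)
  have "cls (\<lambda>x. - 1 * f x) \<oplus>\<^bsub>Linf \<mu>\<^esub> A = \<zero>\<^bsub>Linf \<mu>\<^esub>"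
    using f bounded_borel_cmult[OF f(1), of "- 1"] Linf_add[of "\<lambda>x. - 1 * f x" f] by (simp add: Linf_zero)
  then show "\<exists>B\<in>carrier (Linf \<mu>). B \<oplus>\<^bsub>Linf \<mu>\<^esub> A = \<zero>\<^bsub>Linf \<mu>\<^esub>"
    using carrier_LinfI[OF bounded_borel_cmult[OF f(1), of "- 1"]] by blast
qed

lemma module_Linf: "module (ring_of_type_algebra :: complex ring) (Linf \<mu>)"
proof (rule moduleI)
  let ?R = "ring_of_type_algebra :: complex ring"
  have R: "a \<oplus>\<^bsub>?R\<^esub> b = a + b" "a \<otimes>\<^bsub>?R\<^esub> b = a * b" "\<one>\<^bsub>?R\<^esub> = 1" for a b
    by (simp_all add: ring_of_type_algebra_def)
  show "cring ?R" by (rule cring_from_type_algebra)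
  show "abelian_group (Linf \<mu>)" by (rule abelian_group_Linf)
  fix a b :: complex and A assume "A \<in> carrier (Linf \<mu>)"
  then obtain f where f: "f \<in> bounded_borel" "A = cls f" by (rule carrier_LinfE)
  note cm = bounded_borel_cmult[OF f(1)]
  show "a \<odot>\<^bsub>Linf \<mu>\<^esub> A \<in> carrier (Linf \<mu>)"
    using f cm by (simp add: Linf_smult carrier_LinfI)
  show "(a \<oplus>\<^bsub>?R\<^esub> b) \<odot>\<^bsub>Linf \<mu>\<^esub> A = a \<odot>\<^bsub>Linf \<mu>\<^esub> A \<oplus>\<^bsub>Linf \<mu>\<^esub> b \<odot>\<^bsub>Linf \<mu>\<^esub> A"
    using f cm by (simp add: R Linf_smult Linf_add distrib_right)
  show "(a \<otimes>\<^bsub>?R\<^esub> b) \<odot>\<^bsub>Linf \<mu>\<^esub> A = a \<odot>\<^bsub>Linf \<mu>\<^esub> (b \<odot>\<^bsub>Linf \<mu>\<^esub> A)"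
    using f cm by (simp add: R Linf_smult mult.assoc)
  show "\<one>\<^bsub>?R\<^esub> \<odot>\<^bsub>Linf \<mu>\<^esub> A = A"
    using f by (simp add: R Linf_smult)
  fix B assume "B \<in> carrier (Linf \<mu>)"
  then obtain g where g: "g \<in> bounded_borel" "B = cls g" by (rule carrier_LinfE)
  show "a \<odot>\<^bsub>Linf \<mu>\<^esub> (A \<oplus>\<^bsub>Linf \<mu>\<^esub> B) = a \<odot>\<^bsub>Linf \<mu>\<^esub> A \<oplus>\<^bsub>Linf \<mu>\<^esub> a \<odot>\<^bsub>Linf \<mu>\<^esub> B"
    using f g by (simp add: Linf_smult Linf_add bounded_borel_add bounded_borel_cmult distrib_left)
qed

lemma complex_normed_space_Linf:
  assumes n: "2 \<le> n"
  shows "complex_normed_space (Linf \<mu>) (Linf_gowers_norm \<mu> n)"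
  unfolding complex_normed_space_def
proof (intro conjI ballI allI)
  have n1: "1 \<le> n" using n by simp
  note norm = Linf_gowers_norm_cls[OF _ n1]
  show "module (ring_of_type_algebra :: complex ring) (Linf \<mu>)" by (rule module_Linf)
  fix A assume "A \<in> carrier (Linf \<mu>)"
  then obtain f where f: "f \<in> bounded_borel" "A = cls f" by (rule carrier_LinfE)
  show "0 \<le> Linf_gowers_norm \<mu> n A"
    unfolding f(2) norm[OF f(1)] by (rule gowers_norm_nonneg[OF f(1) n1])
  show "Linf_gowers_norm \<mu> n A = 0 \<longleftrightarrow> A = \<zero>\<^bsub>Linf \<mu>\<^esub>"
    unfolding f(2) norm[OF f(1)] Linf_zero cls_eq_iff[OF f(1) bounded_borel_const]
    by (rule gowers_norm_eq_0_iff[OF f(1) n])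
  show "Linf_gowers_norm \<mu> n (c \<odot>\<^bsub>Linf \<mu>\<^esub> A) = cmod c * Linf_gowers_norm \<mu> n A" for c
    unfolding f(2) Linf_smult[OF f(1)] norm[OF f(1)] norm[OF bounded_borel_cmult[OF f(1)]]
    by (rule gowers_norm_cmult[OF f(1) n1])
  fix B assume "B \<in> carrier (Linf \<mu>)"
  then obtain g where g: "g \<in> bounded_borel" "B = cls g" by (rule carrier_LinfE)
  show "Linf_gowers_norm \<mu> n (A \<oplus>\<^bsub>Linf \<mu>\<^esub> B) \<le> Linf_gowers_norm \<mu> n A + Linf_gowers_norm \<mu> n B"
    unfolding f(2) g(2) Linf_add[OF f(1) g(1)] norm[OF f(1)] norm[OF g(1)]
      norm[OF bounded_borel_add[OF f(1) g(1)]]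
    by (rule gowers_norm_triangle[OF f(1) g(1) n1])
qed

end

text \<open>The first two parts justify conventions in the definitions: \<open>gowers_norm\<close>
  takes a root of a real part, a Bochner integral is \<open>0\<close> for non-integrable functions,
  and \<open>Linf_gowers_norm\<close> evaluates a chosen representative.\<close>

theorem corollary5p9:
  fixes \<mu> :: "'a::topological_group_add measure" and n :: nat
  assumes "compact (UNIV :: 'a set)"
    and "haar_probability \<mu>"
    and "2 \<le> n"
  shows "(\<forall>f\<in>bounded_borel. integrable (haar_power \<mu> n) (gowers_integrand n f) \<and>
            gowers_integral \<mu> n f \<in> \<real> \<and> 0 \<le> Re (gowers_integral \<mu> n f)) \<and>
         (\<forall>f\<in>bounded_borel. \<forall>g\<in>bounded_borel.
            (AE x in \<mu>. f x = g x) \<longrightarrow> gowers_norm \<mu> n f = gowers_norm \<mu> n g) \<and>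
         complex_normed_space (Linf \<mu>) (Linf_gowers_norm \<mu> n)"
proof -
  interpret compact_haar \<mu>
    using assms by unfold_locales
  have n: "1 \<le> n" using assms(3) by simp
  show ?thesis
    using gowers_integral_nonneg[OF _ n] gowers_norm_cong_AE[OF _ _ _ n] complex_normed_space_Linf[OF assms(3)]
    by blast
qed

end
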